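(* Let $1\le k<d$ and $1\le p\le n$ be integers. Let $\{(V_j,\omega_j)\}_{j=1}^n$, with $V_j\in\mathcal{G}_{k,d}$, be a tight $p$-fusion frame that is also a cubature of strength $4$ for $\mathcal{G}_{k,d}$. Let $x\in S^{d-1}$. Then the list $L$ produced by the list reconstruction algorithm (described in the context) from the input $\{\|P_{V_j}(x)\|^2\}_{j=p+1}^n$ is a list of at most $2\,p!$ elements of $S^{d-1}$, and it contains $x$.
   Context: $\mathcal{G}_{k,d}$ is the real Grassmann space of $k$-dimensional linear subspaces of $\mathbb{R}^d$, and $\sigma_k$ is the probability measure on it induced by the Haar measure on $O(\mathbb{R}^d)$. $P_V$ is the orthogonal projector onto $V$, and for $x\in S^{d-1}$ (unit sphere of $\mathbb{R}^d$), $P_x=xx^*$. $\langle A,B\rangle=\operatorname{trace}(AB)$ for symmetric matrices. $(a)_\ell=a(a+1)\cdots(a+\ell-1)$. Tight $p$-fusion frame: $\{(V_j,\omega_j)\}_{j=1}^n$, with positive weights $\omega_j$, is a tight $p$-fusion frame if there is a constant $A_p>0$ with $\sum_{j=1}^n\omega_j\|P_{V_j}(y)\|^{2p}=A_p\|y\|^{2p}$ for all $y\in\mathbb{R}^d$. Cubature of strength $4$: positive weights with $\sum_{j=1}^n\omega_j=1$ such that $\int_{\mathcal{G}_{k,d}} f\,d\sigma_k=\sum_{j=1}^n\omega_j f(V_j)$ for all $f$ in $\operatorname{span}\{V\mapsto \langle P_{x_1},P_V\rangle\langle P_{x_2},P_V\rangle : x_1,x_2\in S^{d-1}\}$. List reconstruction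 algorithm. Input: the numbers $t_j:=\|P_{V_j}(x)\|^2$ for $j=p+1,\dots,n$ (the subspaces and weights are known). (1) Initialize $L=\emptyset$. (2) Compute the set $\mathcal S\subset\mathbb{C}^p$ of solutions $(T_1,\dots,T_p)$ of the algebraic system $$\sum_{j=1}^p\omega_jT_j^\ell=\frac{(k/2)_\ell}{(d/2)_\ell}-\sum_{j=p+1}^n\omega_jt_j^\ell,\qquad 1\le\ell\le p.$$ (3) For every $(t_1,\dots,t_p)\in\mathcal S$ compute $P=a_1\sum_{j=1}^n\omega_jt_jP_{V_j}-a_2I$, where $a_1=\frac{d(d+2)(d-1)}{2k(d-k)}$ and $a_2=\frac{kd+k-2}{2(d-k)}$. (4) If $P$ is a (real orthogonal) projection of rank $1$, compute a unit vector $\xi\in S^{d-1}$ spanning its image and add $\xi$ and $-\xi$ to $L$. Return $L$. *)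

theory Defs
  imports "HOL-Analysis.Analysis"
begin

section \<open>Grassmann space and its invariant probability measure\<close>

definition grassmannian :: "nat \<Rightarrow> (real^'d) set set" where
  "grassmannian k = {V. subspace V \<and> dim V = k}"

definition orth_proj :: "(real^'d) set \<Rightarrow> real^'d \<Rightarrow> real^'d" where
  "orth_proj V y = (THE u. u \<in> V \<and> (\<forall>v\<in>V. orthogonal (y - u) v))"

definition proj_mat :: "(real^'d) set \<Rightarrow> real^'d^'d" where
  "proj_mat V = matrix (orth_proj V)"

definition point_proj :: "real^'d \<Rightarrow> real^'d^'d" where
  "point_proj x = (\<chi> a b. x $ a * x $ b)"

definition trace_inner :: "real^'d^'d \<Rightarrow> real^'d^'d \<Rightarrow> real" where
  "trace_inner A B = trace (A ** B)"

text \<open>Normalised Haar measure on the compact group of orthogonal matrices: the left-invariant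
  Borel probability measure. It exists and is unique; here it is characterised by a predicate
  instead of being constructed.\<close>

definition orthogonal_group :: "(real^'d^'d) set" where
  "orthogonal_group = {Q. orthogonal_matrix Q}"

definition haar_probability :: "(real^'d^'d) measure \<Rightarrow> bool" where
  "haar_probability \<mu> \<longleftrightarrow>
     emeasure \<mu> (space \<mu>) = 1 \<and>
     space \<mu> = orthogonal_group \<and>
     sets \<mu> = sets (restrict_space borel orthogonal_group) \<and>
     (\<forall>Q\<in>orthogonal_group. distr \<mu> \<mu> (\<lambda>R. Q ** R) = \<mu>)"

text \<open>The Grassmann space carries the Borel sets of the topology that it inherits from the
  matrices via the embedding that sends V to its orthogonal projector. The induced measure is the
  image of the Haar measure under the orbit map of a base point; by invariance the choice of
  the base point does not matter.\<close>

definition grassmann_measure ::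
    "(real^'d^'d) measure \<Rightarrow> nat \<Rightarrow> (real^'d) set measure" where
  "grassmann_measure \<mu> k =
     distr \<mu> (vimage_algebra (grassmannian k) proj_mat borel)
       (\<lambda>Q. (\<lambda>v. Q *v v) ` (SOME V. V \<in> grassmannian k))"


section \<open>Fusion frames and cubatures\<close>

definition tight_fusion_frame ::
    "nat \<Rightarrow> nat \<Rightarrow> (nat \<Rightarrow> (real^'d) set) \<Rightarrow> (nat \<Rightarrow> real) \<Rightarrow> bool" where
  "tight_fusion_frame p n V \<omega> \<longleftrightarrow>
     (\<forall>j\<in>{1..n}. \<omega> j > 0) \<and>
     (\<exists>A>0. \<forall>y. (\<Sum>j=1..n. \<omega> j * norm (proj_mat (V j) *v y) ^ (2 * p)) = A * norm y ^ (2 * p))"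

text \<open>The test functions are the finite linear combinations of the products of two inner
  products with rank-one projectors.\<close>

definition cubature4_functions :: "((real^'d) set \<Rightarrow> real) set" where
  "cubature4_functions =
     {f. \<exists>(m::nat) c x y. (\<forall>i<m. norm (x i) = 1 \<and> norm (y i) = 1) \<and>
         f = (\<lambda>V. \<Sum>i<m. c i * (trace_inner (point_proj (x i)) (proj_mat V) *
                              trace_inner (point_proj (y i)) (proj_mat V)))}"

definition cubature_strength4 ::
    "(real^'d) set measure \<Rightarrow> nat \<Rightarrow> (nat \<Rightarrow> (real^'d) set) \<Rightarrow> (nat \<Rightarrow> real) \<Rightarrow> bool" where
  "cubature_strength4 \<sigma> n V \<omega> \<longleftrightarrow>
     (\<forall>j\<in>{1..n}. \<omega> j > 0) \<and> (\<Sum>j=1..n. \<omega> j) = 1 \<and>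
     (\<forall>f\<in>cubature4_functions. (LINT W|\<sigma>. f W) = (\<Sum>j=1..n. \<omega> j * f (V j)))"


section \<open>The list reconstruction algorithm\<close>

text \<open>Points of the p-dimensional complex space are extensional functions on \<open>{1..p}\<close>, so that
  the solution set can be counted. The argument t is only evaluated at the indices in
  \<open>{p+1..n}\<close>.\<close>

definition solution_set ::
    "nat \<Rightarrow> nat \<Rightarrow> nat \<Rightarrow> nat \<Rightarrow> (nat \<Rightarrow> real) \<Rightarrow> (nat \<Rightarrow> real) \<Rightarrow> (nat \<Rightarrow> complex) set" where
  "solution_set k d p n \<omega> t =
     {T \<in> {1..p} \<rightarrow>\<^sub>E UNIV. \<forall>l\<in>{1..p}.
        (\<Sum>j=1..p. of_real (\<omega> j) * T j ^ l) =
        of_real (pochhammer (real k / 2) l / pochhammer (real d / 2) l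
                 - (\<Sum>j=p+1..n. \<omega> j * t j ^ l))}"

definition coeff_a1 :: "nat \<Rightarrow> nat \<Rightarrow> real" where
  "coeff_a1 k d = real d * (real d + 2) * (real d - 1) / (2 * real k * (real d - real k))"

definition coeff_a2 :: "nat \<Rightarrow> nat \<Rightarrow> real" where
  "coeff_a2 k d = (real k * real d + real k - 2) / (2 * (real d - real k))"

text \<open>Since the solutions are complex, so is the reconstructed matrix.\<close>

definition recon_matrix ::
    "nat \<Rightarrow> nat \<Rightarrow> nat \<Rightarrow> (nat \<Rightarrow> (real^'d) set) \<Rightarrow> (nat \<Rightarrow> real) \<Rightarrow> (nat \<Rightarrow> real)
     \<Rightarrow> (nat \<Rightarrow> complex) \<Rightarrow> complex^'d^'d" where
  "recon_matrix k p n V \<omega> t T =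
     (\<chi> a b. of_real (coeff_a1 k CARD('d)) *
              (\<Sum>j=1..n. of_real (\<omega> j) * (if j \<le> p then T j else of_real (t j)) *
                         of_real (proj_mat (V j) $ a $ b))
            - of_real (coeff_a2 k CARD('d)) * mat 1 $ a $ b)"

definition Re_matrix :: "complex^'d^'d \<Rightarrow> real^'d^'d" where
  "Re_matrix P = (\<chi> a b. Re (P $ a $ b))"

definition real_rank_one_projection :: "complex^'d^'d \<Rightarrow> bool" where
  "real_rank_one_projection P \<longleftrightarrow>
     (\<forall>a b. P $ a $ b \<in> \<real>) \<and>
     transpose (Re_matrix P) = Re_matrix P \<and>
     Re_matrix P ** Re_matrix P = Re_matrix P \<and>
     rank (Re_matrix P) = 1"

definition unit_spans_image :: "real^'d \<Rightarrow> complex^'d^'d \<Rightarrow> bool" where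
  "unit_spans_image \<xi> P \<longleftrightarrow> norm \<xi> = 1 \<and> range (\<lambda>v. Re_matrix P *v v) = span {\<xi>}"

text \<open>The algorithm leaves two choices open, namely the order \<open>Ts\<close> in which the solutions are
  processed and the unit vector \<open>\<xi> T\<close> that is picked for a solution T. It is therefore modelled
  as a relation between the input and a possible output list L. The elements of L are recorded
  with repetition. An output exists only if the solution set is finite.\<close>

definition list_reconstruction ::
    "nat \<Rightarrow> nat \<Rightarrow> nat \<Rightarrow> (nat \<Rightarrow> (real^'d) set) \<Rightarrow> (nat \<Rightarrow> real) \<Rightarrow> (nat \<Rightarrow> real)
     \<Rightarrow> (real^'d) list \<Rightarrow> bool" where
  "list_reconstruction k p n V \<omega> t L \<longleftrightarrow>
     (\<exists>Ts \<xi>. distinct Ts \<and> set Ts = solution_set k CARD('d) p n \<omega> t \<and>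
        (\<forall>T\<in>set Ts. real_rank_one_projection (recon_matrix k p n V \<omega> t T) \<longrightarrow>
           unit_spans_image (\<xi> T) (recon_matrix k p n V \<omega> t T)) \<and>
        L = concat (map (\<lambda>T. [\<xi> T, - \<xi> T])
              (filter (\<lambda>T. real_rank_one_projection (recon_matrix k p n V \<omega> t T)) Ts)))"

end

theory Submission
  imports Defs "HOL-Library.Function_Algebras"
begin

text \<open>The Laplacian of \<open>\<parallel>P y\<parallel>\<^sup>2\<^sup>m\<close>, for a projection P of rank k, is
  \<open>2 m (2 m - 2 + k) \<parallel>P y\<parallel>\<^sup>2\<^sup>m\<^sup>-\<^sup>2\<close>. Hence a tight p-fusion frame is tight for every smaller exponent,
  with the constants on the right-hand sides of the algebraic system, and the numbers
  \<open>\<parallel>P\<^sub>j x\<parallel>\<^sup>2\<close> solve it. For this solution the matrix P is the projector onto the line of x: by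
  the cubature property the form \<open>(x, y) \<mapsto> \<Sum>\<^sub>j \<omega>\<^sub>j \<parallel>P\<^sub>j x\<parallel>\<^sup>2 \<parallel>P\<^sub>j y\<parallel>\<^sup>2\<close> is invariant under the
  orthogonal group, so it is a combination of \<open>\<langle>x, y\<rangle>\<^sup>2\<close> and \<open>\<parallel>x\<parallel>\<^sup>2 \<parallel>y\<parallel>\<^sup>2\<close>, whose
  coefficients follow from its values at \<open>y = x\<close> and its trace in y.

  That the system has at most \<open>p!\<close> solutions is Bezout's bound for the weighted power sums
  \<open>f\<^sub>1, \<dots>, f\<^sub>p\<close>. Since the weights are positive, the coordinates are nilpotent modulo these power
  sums. Inductively \<open>f\<^sub>1, \<dots>, f\<^sub>p\<close>, with one more variable y, form a regular sequence modulo which y is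
  not a zero divisor; as a power of y lies in the ideal of \<open>f\<^sub>1, \<dots>, f\<^sub>p\<^sub>+\<^sub>1\<close>, the next power sum
  is not a zero divisor either. Counting dimensions, the quotient by all power sums has dimension
  at most \<open>p!\<close>, and homogeneous representatives of a basis span the functions on every
  fibre of the power sum map.\<close>

section \<open>Codimension of subspaces\<close>

text \<open>Linear independence of the classes of E in the quotient by U, stated without quotient
  spaces. The scalar multiplication s is a parameter because the definition stands outside the
  locale.\<close>

definition independent_mod ::
    "('a::field \<Rightarrow> 'b \<Rightarrow> 'b) \<Rightarrow> 'b set \<Rightarrow> 'b::ab_group_add set \<Rightarrow> bool" where
  "independent_mod s U E \<longleftrightarrow> finite E \<and> (\<forall>c. (\<Sum>e\<in>E. s (c e) e) \<in> U \<longrightarrow> (\<forall>e\<in>E. c e = 0))"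

context vector_space
begin

lemma finite_independent_if_in_finite_span:
  assumes "W \<subseteq> span F" "finite F" "B \<subseteq> W" "independent B"
  shows "finite B"
  using independent_span_bound[OF assms(2,4)] assms by blast

text \<open>A basis of U is extended to a basis of W, and E consists of the added vectors. The
  ambient function space of the applications is infinite-dimensional; F keeps the bases of W
  finite.\<close>

lemma complement_exists:
  assumes U: "subspace U" "U \<subseteq> W" and W: "W \<subseteq> span F" "finite F"
  obtains E where "E \<subseteq> W" "finite E" "card E + dim U = dim W" "W \<subseteq> span (U \<union> E)"
    "independent_mod scale U E"
proof -
  obtain B where B: "B \<subseteq> U" "independent B" "U \<subseteq> span B" "card B = dim U"
    using basis_exists[of U] by blast
  obtain D where D: "B \<subseteq> D" "D \<subseteq> W" "independent D" "W \<subseteq> span D"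
    using maximal_independent_subset_extend[of B W] B U by blast
  have fD: "finite D"
    using finite_independent_if_in_finite_span[OF W D(2,3)] .
  have fB: "finite B" using fD D(1) finite_subset by blast
  have dW: "card D = dim W" using basis_card_eq_dim[OF D(2,4,3)] .
  let ?E = "D - B"
  have ind: "\<forall>e\<in>?E. c e = 0" if c: "(\<Sum>e\<in>?E. c e *s e) \<in> U" for c
  proof -
    have "(\<Sum>e\<in>?E. c e *s e) \<in> span B" using c B by blast
    then obtain b where b: "(\<Sum>e\<in>?E. c e *s e) = (\<Sum>e\<in>B. b e *s e)"
      using span_finite[OF fB] by auto
    \<comment> \<open>The coefficients of the relation on D that arises when the expansion in B is
      moved to the other side.\<close>
    define g where "g e = (if e \<in> B then - b e else c e)" for e
    have "(\<Sum>e\<in>D. g e *s e) = (\<Sum>e\<in>?E. g e *s e) + (\<Sum>e\<in>B. g e *s e)"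
      using sum.subset_diff[OF D(1) fD] .
    also have "(\<Sum>e\<in>?E. g e *s e) = (\<Sum>e\<in>?E. c e *s e)"
      by (intro sum.cong) (auto simp: g_def)
    also have "(\<Sum>e\<in>B. g e *s e) = - (\<Sum>e\<in>B. b e *s e)"
      by (simp add: g_def sum_negf)
    finally have "(\<Sum>e\<in>D. g e *s e) = 0" using b by simp
    then have "\<forall>e\<in>D. g e = 0"
      using D(3) fD independent_explicit_finite_subsets by blast
    then show ?thesis by (auto simp: g_def)
  qed
  have "W \<subseteq> span (U \<union> ?E)"
    using D(4) span_mono[of D "U \<union> ?E"] B(1) by blast
  moreover have "card ?E + dim U = dim W"
    using card_Diff_subset[OF fB D(1)] card_mono[OF fD D(1)] B(4) dW by simp
  ultimately show thesis
    using that[of ?E] D(2) fD ind unfolding independent_mod_def by blast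
qed

text \<open>A basis of U together with E is an independent subset of W.\<close>

lemma card_independent_mod_le:
  assumes U: "U \<subseteq> W" and E: "independent_mod scale U E" "E \<subseteq> W" and sub: "subspace U"
    and W: "W \<subseteq> span F" "finite F"
  shows "card E + dim U \<le> dim W"
proof -
  obtain B where B: "B \<subseteq> U" "independent B" "U \<subseteq> span B" "card B = dim U"
    using basis_exists[of U] by blast
  have fB: "finite B"
    using finite_independent_if_in_finite_span[OF W _ B(2)] B(1) U by blast
  have fE: "finite E" and Ei: "\<And>c. (\<Sum>e\<in>E. c e *s e) \<in> U \<Longrightarrow> (\<forall>e\<in>E. c e = 0)"
    using E(1) unfolding independent_mod_def by auto
  have disj: "B \<inter> E = {}"
  proof (rule ccontr)
    assume "B \<inter> E \<noteq> {}"
    then obtain e where e: "e \<in> B" "e \<in> E" by blast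
    have "(\<Sum>x\<in>E. (if x = e then 1 else 0) *s x) = (\<Sum>x\<in>E. if x = e then e else 0)"
      by (intro sum.cong) auto
    also have "\<dots> = e" using e fE by simp
    finally have "(\<Sum>x\<in>E. (if x = e then 1 else 0) *s x) = e" .
    with e B(1) have "(\<Sum>x\<in>E. (if x = e then 1 else 0) *s x) \<in> U" by auto
    from Ei[OF this] e show False by auto
  qed
  have ind: "independent (B \<union> E)"
  proof (rule independent_if_scalars_zero)
    show "finite (B \<union> E)" using fB fE by simp
    fix c x assume s: "(\<Sum>x\<in>B \<union> E. c x *s x) = 0" and x: "x \<in> B \<union> E"
    have s': "(\<Sum>x\<in>B. c x *s x) + (\<Sum>x\<in>E. c x *s x) = 0"
      using s sum.union_disjoint[OF fB fE disj, of "\<lambda>x. c x *s x"] by simp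
    then have "(\<Sum>x\<in>E. c x *s x) = - (\<Sum>x\<in>B. c x *s x)"
      by (simp add: eq_neg_iff_add_eq_0 add.commute)
    moreover have "- (\<Sum>x\<in>B. c x *s x) \<in> U"
      using sub B(1) by (intro subspace_neg subspace_sum subspace_scale) auto
    ultimately have cE: "\<forall>e\<in>E. c e = 0" using Ei by metis
    then have "(\<Sum>x\<in>B. c x *s x) = 0" using s' by simp
    then have "\<forall>e\<in>B. c e = 0"
      using B(2) fB independent_explicit_finite_subsets by blast
    with cE x show "c x = 0" by blast
  qed
  obtain D where D: "D \<subseteq> W" "independent D" "W \<subseteq> span D" "card D = dim W"
    using basis_exists[of W] by blast
  have fD: "finite D" using finite_independent_if_in_finite_span[OF W D(1,2)] .
  have "card (B \<union> E) \<le> card D"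
    using independent_span_bound[OF fD ind] D B(1) U E(2) by blast
  then show ?thesis using card_Un_disjoint[OF fB fE disj] B(4) D(4) by simp
qed

lemma dim_le_dim_plus_card:
  assumes "W \<subseteq> span (U \<union> E)" "finite E" "U \<subseteq> span F" "finite F"
  shows "dim W \<le> dim U + card E"
proof -
  obtain B where B: "B \<subseteq> U" "independent B" "U \<subseteq> span B" "card B = dim U"
    using basis_exists[of U] by blast
  have fB: "finite B" using finite_independent_if_in_finite_span[OF assms(3,4) B(1,2)] .
  have "span (U \<union> E) \<subseteq> span (B \<union> E)"
  proof (rule span_minimal)
    show "U \<union> E \<subseteq> span (B \<union> E)"
      using B(3) span_mono[of B "B \<union> E"] span_superset[of "B \<union> E"] by blast
  qed simp
  then have "dim W \<le> card (B \<union> E)"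
    using assms fB by (intro dim_le_card) auto
  also have "\<dots> \<le> card B + card E" by (rule card_Un_le)
  finally show ?thesis using B(4) by simp
qed

text \<open>On W1 the map \<open>\<phi>\<close> followed by the projection to the quotient of U' by
  U has its kernel inside U1, so a complement of U1 in W1 is sent to vectors independent modulo U.
  The two codimensions are compared additively because \<open>dim\<close> is a natural
  number.\<close>

lemma dim_le_codim_injective_mod:
  assumes U: "subspace U" "U \<subseteq> U'" "U' \<subseteq> span F" "finite F"
    and U1: "subspace U1" "U1 \<subseteq> W1" "W1 \<subseteq> span F1" "finite F1" "subspace W1"
    and \<phi>: "module_hom scale scale \<phi>" "\<phi> ` W1 \<subseteq> U'" "\<And>x. x \<in> W1 \<Longrightarrow> \<phi> x \<in> U \<Longrightarrow> x \<in> U1"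
  shows "dim W1 + dim U \<le> dim U' + dim U1"
proof -
  interpret \<phi>: module_hom scale scale \<phi> by fact
  obtain E where E: "E \<subseteq> W1" "finite E" "card E + dim U1 = dim W1" "independent_mod scale U1 E"
    using complement_exists[OF U1(1-4)] by metis
  have Ei: "\<And>c. (\<Sum>e\<in>E. c e *s e) \<in> U1 \<Longrightarrow> (\<forall>e\<in>E. c e = 0)"
    using E(4) unfolding independent_mod_def by auto
  have key: "\<forall>e\<in>E. c e = 0" if "(\<Sum>e\<in>E. c e *s \<phi> e) \<in> U" for c
  proof -
    have "\<phi> (\<Sum>e\<in>E. c e *s e) \<in> U" using that by (simp add: \<phi>.sum \<phi>.scale)
    moreover have "(\<Sum>e\<in>E. c e *s e) \<in> W1"
      using E(1) U1(5) by (intro subspace_sum subspace_scale) auto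
    ultimately show ?thesis using \<phi>(3) Ei by blast
  qed
  have inj: "inj_on \<phi> E"
  proof (rule inj_onI, rule ccontr)
    fix a b assume ab: "a \<in> E" "b \<in> E" "\<phi> a = \<phi> b" "a \<noteq> b"
    \<comment> \<open>If a and b had the same image, this would be a relation between images with a
      nonzero coefficient at a.\<close>
    define c :: "'b \<Rightarrow> 'a" where "c e = (if e = a then 1 else if e = b then -1 else 0)" for e
    have "(\<Sum>e\<in>E. c e *s \<phi> e) = (\<Sum>e\<in>{a,b}. c e *s \<phi> e)"
      using ab E(2) by (intro sum.mono_neutral_right) (auto simp: c_def)
    also have "\<dots> = 0" using ab by (simp add: c_def)
    also have "\<dots> \<in> U" using U(1) subspace_0 by blast
    finally have "c a = 0" using key ab by blast
    then show False by (simp add: c_def)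
  qed
  have "independent_mod scale U (\<phi> ` E)"
    unfolding independent_mod_def
  proof (intro conjI allI impI ballI)
    show "finite (\<phi> ` E)" using E(2) by simp
    fix c e assume c: "(\<Sum>e\<in>\<phi> ` E. c e *s e) \<in> U" and e: "e \<in> \<phi> ` E"
    have "(\<Sum>e\<in>E. c (\<phi> e) *s \<phi> e) \<in> U" using c by (simp add: sum.reindex[OF inj])
    from key[OF this] e show "c e = 0" by auto
  qed
  then have "card (\<phi> ` E) + dim U \<le> dim U'"
    using E(1) \<phi>(2) by (intro card_independent_mod_le[OF U(2) _ _ U(1,3,4)]) auto
  then show ?thesis using card_image[OF inj] E(3) by simp
qed

end

section \<open>Homogeneous polynomial functions and weighted power sums\<close>

lemma sum_fun_apply: "(\<Sum>i\<in>A. f i) x = (\<Sum>i\<in>A. f i x)"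
  for f :: "'i \<Rightarrow> 'x \<Rightarrow> 'y::comm_monoid_add"
  by (induction A rule: infinite_finite_induct) (auto simp: zero_fun_apply one_fun_apply plus_fun_apply times_fun_apply)

lemma power_fun_apply: "(f ^ n) x = f x ^ n" for f :: "'x \<Rightarrow> 'y::monoid_mult"
  by (induction n) (auto simp: zero_fun_apply one_fun_apply plus_fun_apply times_fun_apply)

text \<open>Polynomial functions are calculated with as elements of a commutative ring; evaluation
  at a point is unfolded only on demand, through \<open>pointwise\<close>.\<close>

declare plus_fun_apply [simp del] times_fun_apply [simp del] zero_fun_apply [simp del]
  one_fun_apply [simp del] minus_apply [simp del] uminus_apply [simp del]

type_synonym polyfun = "(nat \<Rightarrow> complex) \<Rightarrow> complex"

definition cst :: "complex \<Rightarrow> polyfun" where "cst c = (\<lambda>_. c)"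

definition coord :: "nat \<Rightarrow> polyfun" where "coord i = (\<lambda>T. T i)"

lemma cst_apply: "cst c T = c" and coord_apply: "coord i T = T i"
  by (simp_all add: cst_def coord_def)

lemmas pointwise = plus_fun_apply times_fun_apply zero_fun_apply one_fun_apply minus_apply
  uminus_apply sum_fun_apply power_fun_apply cst_apply coord_apply

text \<open>Polynomials are represented by the functions that they induce. Degrees are integers, so that
  the component of degree \<open>s - l\<close> is zero for \<open>l > s\<close>.\<close>

inductive homog :: "nat \<Rightarrow> int \<Rightarrow> polyfun \<Rightarrow> bool" for p where
  zero: "homog p s 0"
| const: "homog p 0 (cst c)"
| add: "homog p s g \<Longrightarrow> homog p s h \<Longrightarrow> homog p s (g + h)"
| coord_mult: "homog p s g \<Longrightarrow> i \<in> {1..p} \<Longrightarrow> homog p (s + 1) (coord i * g)"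

lemma homog_negative: "homog p s g \<Longrightarrow> s < 0 \<Longrightarrow> g = 0"
  by (induction rule: homog.induct) auto

lemma homog_cmult: "homog p s g \<Longrightarrow> homog p s (cst c * g)"
proof (induction rule: homog.induct)
  case (const c')
  have "cst c * cst c' = cst (c * c')" by (simp add: fun_eq_iff pointwise)
  then show ?case by (simp add: homog.const)
next
  case (coord_mult s g i)
  have "cst c * (coord i * g) = coord i * (cst c * g)" by (simp add: algebra_simps)
  then show ?case using homog.coord_mult[OF coord_mult.IH coord_mult.hyps(2)] by metis
qed (auto simp: distrib_left intro: homog.intros)

lemma homog_mult: "homog p s g \<Longrightarrow> homog p r h \<Longrightarrow> homog p (s + r) (g * h)"
proof (induction rule: homog.induct)
  case (coord_mult s g i)
  then have "homog p (s + r + 1) (coord i * (g * h))" by (intro homog.coord_mult) auto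
  then show ?case by (simp add: algebra_simps)
qed (auto simp: distrib_right intro: homog.intros homog_cmult)

lemma homog_mult': "homog p s g \<Longrightarrow> homog p r h \<Longrightarrow> s + r = t \<Longrightarrow> homog p t (g * h)"
  using homog_mult by blast

lemma homog_uminus: "homog p s g \<Longrightarrow> homog p s (- g)"
proof -
  have "- g = cst (- 1) * g" by (simp add: fun_eq_iff pointwise)
  then show "homog p s g \<Longrightarrow> homog p s (- g)" by (simp add: homog_cmult)
qed

lemma homog_diff: "homog p s g \<Longrightarrow> homog p s h \<Longrightarrow> homog p s (g - h)"
  using homog.add[of p s g "- h"] homog_uminus by simp

lemma homog_sum: "(\<And>i. i \<in> A \<Longrightarrow> homog p s (g i)) \<Longrightarrow> homog p s (\<Sum>i\<in>A. g i)"
  by (induction A rule: infinite_finite_induct) (auto intro: homog.zero homog.add)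

lemma homog_mono: "homog p s g \<Longrightarrow> p \<le> q \<Longrightarrow> homog q s g"
  by (induction rule: homog.induct) (auto intro: homog.intros)

lemma homog_one: "homog p 0 1"
proof -
  have "(1::polyfun) = cst 1" by (simp add: fun_eq_iff pointwise)
  then show ?thesis using homog.const by metis
qed

lemma homog_coord: "i \<in> {1..p} \<Longrightarrow> homog p 1 (coord i)"
  using homog.coord_mult[OF homog_one, of i p] by simp

lemma homog_power: "homog p s g \<Longrightarrow> homog p (int k * s) (g ^ k)"
proof (induction k)
  case (Suc k)
  then show ?case using homog_mult[of p s g "int k * s" "g ^ k"] by (simp add: algebra_simps)
qed (simp add: homog_one)

text \<open>The decomposition behind the inductions on the number of variables: g0 is g with the
  last variable set to 0, and the rest is divisible by that variable.\<close>

lemma homog_split: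
  assumes "homog (Suc p) s g"
  shows "\<exists>g0 g1. homog p s g0 \<and> homog (Suc p) (s - 1) g1 \<and> g = g0 + coord (Suc p) * g1"
  using assms
proof (induction rule: homog.induct)
  case (zero s)
  then show ?case by (intro exI[of _ 0]) (simp add: homog.zero)
next
  case (const c)
  then show ?case by (intro exI[of _ "cst c"] exI[of _ 0]) (simp add: homog.zero homog.const)
next
  case (add s g h)
  then obtain g0 g1 h0 h1 where
    "homog p s g0" "homog (Suc p) (s - 1) g1" "g = g0 + coord (Suc p) * g1"
    "homog p s h0" "homog (Suc p) (s - 1) h1" "h = h0 + coord (Suc p) * h1"
    by blast
  then show ?case
    by (intro exI[of _ "g0 + h0"] exI[of _ "g1 + h1"]) (auto simp: algebra_simps intro: homog.add)
next
  case (coord_mult s g i)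
  then obtain g0 g1 where g:
    "homog p s g0" "homog (Suc p) (s - 1) g1" "g = g0 + coord (Suc p) * g1"
    by blast
  show ?case
  proof (cases "i = Suc p")
    case True
    then show ?thesis using coord_mult.hyps
      by (intro exI[of _ 0] exI[of _ g]) (auto simp: homog.zero)
  next
    case False
    then have i: "i \<in> {1..p}" using coord_mult.hyps(2) by auto
    have "coord i * g = coord i * g0 + coord (Suc p) * (coord i * g1)"
      by (simp add: g(3) algebra_simps)
    moreover have "homog (Suc p) (s + 1 - 1) (coord i * g1)"
      using homog.coord_mult[OF g(2) coord_mult.hyps(2)] by simp
    ultimately show ?thesis using homog.coord_mult[OF g(1) i] by blast
  qed
qed

lemma homog_cong_outside: "homog p s g \<Longrightarrow> j \<notin> {1..p} \<Longrightarrow> g (T(j := c)) = g T"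
  by (induction rule: homog.induct) (auto simp: pointwise)

lemma homog_continuous_coordinate:
  "homog p s g \<Longrightarrow> continuous_on UNIV (\<lambda>c. g (T(j := c)))"
proof (induction rule: homog.induct)
  case (coord_mult s g i)
  then show ?case
    by (cases "i = j") (auto simp: pointwise intro!: continuous_intros)
qed (auto simp: pointwise intro!: continuous_intros)

text \<open>For functions, the hypothesis only says that u vanishes where the j-th coordinate is
  nonzero. Continuity in that coordinate extends this to the value 0.\<close>

lemma homog_coord_cancel:
  assumes "homog p s u" "coord j * u = 0"
  shows "u = 0"
proof
  fix T
  have "u (T(j := c)) = 0" if "c \<noteq> 0" for c
    using fun_cong[OF assms(2), of "T(j := c)"] that by (simp add: pointwise)
  then have "-{0} \<subseteq> {c. u (T(j := c)) = 0}" by auto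
  moreover have "closed {c. u (T(j := c)) = 0}"
    by (intro closed_Collect_eq homog_continuous_coordinate[OF assms(1)] continuous_on_const)
  ultimately have "closure (-{0}) \<subseteq> {c. u (T(j := c)) = 0}"
    by (rule closure_minimal)
  moreover have "T j \<in> closure (-{0})" by (simp add: closure_complement)
  ultimately have "u (T(j := T j)) = 0" by blast
  then show "u T = 0 T" by (simp add: pointwise)
qed

text \<open>The part of g that is free of the last variable equals g at the value 0 of that
  variable, hence vanishes.\<close>

lemma homog_divide_coord:
  assumes g: "homog (Suc p) s g" and z: "\<And>T. g (T(Suc p := 0)) = 0"
  obtains h where "homog (Suc p) (s - 1) h" "g = coord (Suc p) * h"
proof -
  obtain g0 g1 where gs:
    "homog p s g0" "homog (Suc p) (s - 1) g1" "g = g0 + coord (Suc p) * g1"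
    using homog_split[OF g] by blast
  have "g0 T = 0" for T
    using z[of T] homog_cong_outside[OF gs(1), of "Suc p" T 0] by (simp add: gs(3) pointwise)
  then have "g = coord (Suc p) * g1" by (simp add: gs(3) fun_eq_iff pointwise)
  with gs(2) show thesis using that by blast
qed

section \<open>Weighted power sums, and graded ideals given by their components\<close>

definition psum :: "(nat \<Rightarrow> real) \<Rightarrow> nat \<Rightarrow> nat \<Rightarrow> polyfun" where
  "psum w p l = (\<Sum>i=1..p. cst (of_real (w i)) * coord i ^ l)"

lemma psum_apply: "psum w p l T = (\<Sum>i=1..p. of_real (w i) * T i ^ l)"
  by (simp add: psum_def pointwise)

lemma homog_psum: "homog p (int l) (psum w p l)"
  unfolding psum_def
  using homog_power[OF homog_coord] by (intro homog_sum homog_cmult) simp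

lemma homog_psum_mult: "homog p (s - int l) h \<Longrightarrow> homog p s (psum w p l * h)"
  using homog_mult[OF homog_psum, of p "s - int l" h l w] by simp

text \<open>For \<open>l = 0\<close> the last variable would still contribute its weight, as
  \<open>0 ^ 0 = 1\<close>.\<close>

lemma psum_at_zero: "1 \<le> l \<Longrightarrow> psum w (Suc p) l (T(Suc p := 0)) = psum w p l T"
  by (simp add: psum_apply)

text \<open>The component of degree s of the ideal generated by the first q power sums in p
  variables. The numbers p and q are separate because variables and power sums are added one at a
  time.\<close>

definition psum_ideal :: "(nat \<Rightarrow> real) \<Rightarrow> nat \<Rightarrow> nat \<Rightarrow> int \<Rightarrow> polyfun set" where
  "psum_ideal w p q s =
     {g. \<exists>h. (\<forall>l\<in>{1..q}. homog p (s - int l) (h l)) \<and> g = (\<Sum>l=1..q. psum w p l * h l)}"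

lemma psum_idealI:
  "(\<And>l. l \<in> {1..q} \<Longrightarrow> homog p (s - int l) (h l)) \<Longrightarrow>
   (\<Sum>l=1..q. psum w p l * h l) \<in> psum_ideal w p q s"
  unfolding psum_ideal_def by blast

lemma psum_idealE:
  assumes "g \<in> psum_ideal w p q s"
  obtains h where "\<forall>l\<in>{1..q}. homog p (s - int l) (h l)" "g = (\<Sum>l=1..q. psum w p l * h l)"
  using assms unfolding psum_ideal_def by blast

text \<open>Homogeneous ideals in general, as families of components, so that the nilpotency
  argument can also run in ideals enlarged by further linear forms.\<close>

definition graded_ideal :: "nat \<Rightarrow> (int \<Rightarrow> polyfun set) \<Rightarrow> bool" where
  "graded_ideal p I \<longleftrightarrow>
     (\<forall>s. 0 \<in> I s) \<and> (\<forall>s. \<forall>g\<in>I s. homog p s g) \<and> (\<forall>s. \<forall>g\<in>I s. \<forall>h\<in>I s. g + h \<in> I s) \<and>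
     (\<forall>s r g h. homog p s g \<longrightarrow> h \<in> I r \<longrightarrow> g * h \<in> I (s + r))"

context
  fixes p I
  assumes I: "graded_ideal p I"
begin

lemma graded_ideal_homog: "g \<in> I s \<Longrightarrow> homog p s g"
  using I unfolding graded_ideal_def by blast

lemma graded_ideal_zero: "0 \<in> I s"
  using I unfolding graded_ideal_def by blast

lemma graded_ideal_add: "g \<in> I s \<Longrightarrow> h \<in> I s \<Longrightarrow> g + h \<in> I s"
  using I unfolding graded_ideal_def by blast

lemma graded_ideal_mult: "homog p s g \<Longrightarrow> h \<in> I r \<Longrightarrow> s + r = t \<Longrightarrow> g * h \<in> I t"
  using I unfolding graded_ideal_def by blast

lemma graded_ideal_cmult: "g \<in> I s \<Longrightarrow> cst c * g \<in> I s"
  using graded_ideal_mult[OF homog.const] by simp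

lemma graded_ideal_uminus: "g \<in> I s \<Longrightarrow> - g \<in> I s"
proof -
  have "- g = cst (- 1) * g" by (simp add: fun_eq_iff pointwise)
  then show "g \<in> I s \<Longrightarrow> - g \<in> I s" by (simp add: graded_ideal_cmult)
qed

lemma graded_ideal_diff: "g \<in> I s \<Longrightarrow> h \<in> I s \<Longrightarrow> g - h \<in> I s"
  using graded_ideal_add[OF _ graded_ideal_uminus, of g s h] by simp

end

lemma graded_ideal_psum_ideal: "graded_ideal p (psum_ideal w p q)"
  unfolding graded_ideal_def
proof (intro conjI allI ballI impI)
  fix s
  show "0 \<in> psum_ideal w p q s"
    using psum_idealI[of q p s "\<lambda>_. 0"] by (simp add: homog.zero)
  show "homog p s g" if "g \<in> psum_ideal w p q s" for g
    using that by (elim psum_idealE) (auto intro!: homog_sum homog_psum_mult)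
  show "g + h \<in> psum_ideal w p q s" if gh: "g \<in> psum_ideal w p q s" "h \<in> psum_ideal w p q s" for g h
  proof -
    obtain a where a: "\<forall>l\<in>{1..q}. homog p (s - int l) (a l)" "g = (\<Sum>l=1..q. psum w p l * a l)"
      using gh(1) by (rule psum_idealE)
    obtain b where b: "\<forall>l\<in>{1..q}. homog p (s - int l) (b l)" "h = (\<Sum>l=1..q. psum w p l * b l)"
      using gh(2) by (rule psum_idealE)
    have "g + h = (\<Sum>l=1..q. psum w p l * (a l + b l))"
      by (simp add: a b distrib_left sum.distrib)
    then show ?thesis using psum_idealI[of q p s "\<lambda>l. a l + b l"] a(1) b(1) homog.add by simp
  qed
  show "g * h \<in> psum_ideal w p q (s + r)" if g: "homog p s g" and h: "h \<in> psum_ideal w p q r" for r g h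
  proof -
    obtain b where b: "\<forall>l\<in>{1..q}. homog p (r - int l) (b l)" "h = (\<Sum>l=1..q. psum w p l * b l)"
      using h by (rule psum_idealE)
    have "g * h = (\<Sum>l=1..q. psum w p l * (g * b l))"
      by (simp add: b sum_distrib_left algebra_simps)
    moreover have "homog p (s + r - int l) (g * b l)" if "l \<in> {1..q}" for l
      using homog_mult[OF g b(1)[rule_format, OF that]] by (simp add: algebra_simps)
    ultimately show ?thesis using psum_idealI[of q p "s + r" "\<lambda>l. g * b l"] by simp
  qed
qed

lemma psum_mem_psum_ideal: "1 \<le> l \<Longrightarrow> l \<le> q \<Longrightarrow> psum w p l \<in> psum_ideal w p q (int l)"
proof -
  assume l: "1 \<le> l" "l \<le> q"
  have "(\<Sum>m=1..q. psum w p m * (if m = l then 1 else 0)) \<in> psum_ideal w p q (int l)"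
    by (rule psum_idealI) (auto simp: homog_one homog.zero)
  also have "(\<Sum>m=1..q. psum w p m * (if m = l then 1 else 0)) = psum w p l"
    using l by (simp add: if_distrib[of "\<lambda>x. _ * x"] cong: if_cong)
  finally show ?thesis .
qed

section \<open>Nilpotency modulo weighted power sums\<close>

text \<open>These are the components of the ideal generated by I and b. With
  \<open>b = a j - a i\<close> it models the quotient in which the forms \<open>a i\<close> and
  \<open>a j\<close> coincide.\<close>

lemma graded_ideal_adjoin:
  assumes I: "graded_ideal p I" and b: "homog p 1 b"
  shows "graded_ideal p (\<lambda>s. {u + b * r | u r. u \<in> I s \<and> homog p (s - 1) r})"
    (is "graded_ideal p ?J")
  unfolding graded_ideal_def
proof (intro conjI allI ballI impI)
  fix s
  show "0 \<in> ?J s"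
    using graded_ideal_zero[OF I] homog.zero[of p "s - 1"] by force
  show "homog p s g" if gJ: "g \<in> ?J s" for g
  proof -
    obtain u r where "g = u + b * r" "u \<in> I s" "homog p (s - 1) r" using gJ by blast
    moreover have "homog p s (b * r)"
      using \<open>homog p (s - 1) r\<close> by (intro homog_mult'[OF b]) auto
    ultimately show ?thesis using graded_ideal_homog[OF I] homog.add by blast
  qed
  show "g + h \<in> ?J s" if gh: "g \<in> ?J s" "h \<in> ?J s" for g h
  proof -
    obtain u r u' r' where "g = u + b * r" "u \<in> I s" "homog p (s - 1) r"
      "h = u' + b * r'" "u' \<in> I s" "homog p (s - 1) r'"
      using gh by blast
    moreover from this have "g + h = (u + u') + b * (r + r')" by (simp add: algebra_simps)
    ultimately show ?thesis using graded_ideal_add[OF I] homog.add by blast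
  qed
  show "g * h \<in> ?J (s + r)" if g: "homog p s g" and h: "h \<in> ?J r" for r g h
  proof -
    obtain u v where "h = u + b * v" "u \<in> I r" "homog p (r - 1) v" using h by blast
    moreover from this have "g * h = g * u + b * (g * v)" by (simp add: algebra_simps)
    moreover have "homog p (s + r - 1) (g * v)" if "homog p (r - 1) v" for v
      by (rule homog_mult'[OF g that]) simp
    ultimately show ?thesis using graded_ideal_mult[OF I g] by blast
  qed
qed

text \<open>Summing \<open>w i * a i * g (a i)\<close> for the polynomial g with the roots \<open>a z\<close>, \<open>z \<in> X - {j}\<close>,
  isolates the index j. Expanding g root by root avoids naming its coefficients.\<close>

lemma power_sums_isolate:
  fixes w :: "'i \<Rightarrow> real"
  assumes I: "graded_ideal p I" and X: "finite X" and a: "\<And>i. i \<in> X \<Longrightarrow> homog p 1 (a i)"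
    and ps: "\<And>m. m \<in> {1..card X} \<Longrightarrow> (\<Sum>i\<in>X. cst (of_real (w i)) * a i ^ m) \<in> I (int m)"
    and "finite Y" "Y \<subseteq> X" "1 + k + card Y \<le> card X"
  shows "(\<Sum>i\<in>X. cst (of_real (w i)) * (a i ^ (1 + k) * (\<Prod>z\<in>Y. a i - a z))) \<in> I (int (1 + k + card Y))"
  using assms(5-7)
proof (induction Y arbitrary: k rule: finite_induct)
  case empty
  then show ?case using ps[of "1 + k"] by simp
next
  case (insert z Y)
  define S where "S k = (\<Sum>i\<in>X. cst (of_real (w i)) * (a i ^ (1 + k) * (\<Prod>z\<in>Y. a i - a z)))" for k
  have c: "card (insert z Y) = Suc (card Y)" using insert by simp
  have S1: "S (Suc k) \<in> I (int (1 + Suc k + card Y))" and S0: "S k \<in> I (int (1 + k + card Y))"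
    unfolding S_def using insert.prems c by (intro insert.IH; simp)+
  \<comment> \<open>Of the two terms of the factor \<open>a i - a z\<close>, one raises the exponent
    of \<open>a i\<close> and the other pulls out \<open>a z\<close>. This is why k varies in the
    induction.\<close>
  have "(\<Sum>i\<in>X. cst (of_real (w i)) * (a i ^ (1 + k) * (\<Prod>z\<in>insert z Y. a i - a z)))
      = S (Suc k) - a z * S k"
    unfolding S_def sum_distrib_left sum_subtractf[symmetric]
    using insert.hyps by (intro sum.cong) (simp_all add: algebra_simps)
  also have "\<dots> \<in> I (int (1 + k + card (insert z Y)))"
  proof (rule graded_ideal_diff[OF I])
    show "S (Suc k) \<in> I (int (1 + k + card (insert z Y)))" using S1 c by simp
    have "homog p 1 (a z)" using a insert.prems by blast
    then show "a z * S k \<in> I (int (1 + k + card (insert z Y)))"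
      using c by (intro graded_ideal_mult[OF I _ S0]) simp_all
  qed
  finally show ?case .
qed

text \<open>Induction on the number of forms. Identifying \<open>a i\<close> with \<open>a j\<close>
  merges their weights, and the merged weight is again positive, so a power of \<open>a j\<close>
  lies in the ideal enlarged by \<open>a j - a i\<close>. Multiplying over all i puts a power of
  \<open>a j\<close> into the ideal enlarged by the product of these differences, and
  \<open>a j\<close> times that product lies in I by \<open>power_sums_isolate\<close>.\<close>

lemma nilpotent_if_power_sums_in_ideal:
  fixes w :: "'i \<Rightarrow> real"
  assumes "graded_ideal p I" "finite X" "\<And>i. i \<in> X \<Longrightarrow> homog p 1 (a i)"
    and "\<And>i. i \<in> X \<Longrightarrow> 0 < w i"
    and "\<And>m. m \<in> {1..card X} \<Longrightarrow> (\<Sum>i\<in>X. cst (of_real (w i)) * a i ^ m) \<in> I (int m)"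
    and "j \<in> X"
  shows "\<exists>N. a j ^ N \<in> I (int N)"
  using assms
proof (induction "card X" arbitrary: X w I rule: less_induct)
  case (less X w I)
  note I = less.prems(1) and X = less.prems(2) and a = less.prems(3) and w = less.prems(4)
    and ps = less.prems(5) and j = less.prems(6)
  have ex: "\<exists>N r. homog p (int N - 1) r \<and> a j ^ N - (a j - a i) * r \<in> I (int N)"
    if i: "i \<in> X - {j}" for i
  proof -
    \<comment> \<open>The index i is dropped and its weight is given to j.\<close>
    define w' where "w' = w(j := w j + w i)"
    define J where "J = (\<lambda>s. {u + (a j - a i) * r | u r. u \<in> I s \<and> homog p (s - 1) r})"
    have J: "graded_ideal p J"
      unfolding J_def using a i j by (intro graded_ideal_adjoin[OF I] homog_diff) auto
    have IJ: "u \<in> J s" if "u \<in> I s" for u s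
      unfolding J_def using that homog.zero[of p "s - 1"] by force
    have "\<exists>N. a j ^ N \<in> J (int N)"
    proof (rule less.hyps[OF _ J])
      show "card (X - {i}) < card X"
        using i X by (metis Diff_iff card_Diff1_less)
      show "finite (X - {i})" using X by simp
      show "homog p 1 (a i')" if "i' \<in> X - {i}" for i' using a that by blast
      show "0 < w' i'" if "i' \<in> X - {i}" for i' using w that i j unfolding w'_def by (auto simp: add_pos_pos)
      show "j \<in> X - {i}" using i j by blast
      fix m assume m: "m \<in> {1..card (X - {i})}"
      have m1: "m \<in> {1..card X}" using m i X by auto
      have "(\<Sum>z\<in>X - {i}. cst (of_real (w' z)) * a z ^ m)
          = (\<Sum>z\<in>X - {i} - {j}. cst (of_real (w z)) * a z ^ m) + cst (of_real (w j + w i)) * a j ^ m"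
        using X i j by (subst sum.remove[of _ j]) (auto simp: w'_def)
      also have "cst (of_real (w j + w i)) = cst (of_real (w j)) + cst (of_real (w i))"
        by (simp add: fun_eq_iff pointwise)
      \<comment> \<open>The merged power sum arises from the given one by replacing
        \<open>a i ^ m\<close> with \<open>a j ^ m\<close>, at the cost of a multiple of
        \<open>a j - a i\<close>.\<close>
      also have "(\<Sum>z\<in>X - {i} - {j}. cst (of_real (w z)) * a z ^ m)
          + (cst (of_real (w j)) + cst (of_real (w i))) * a j ^ m
          = (\<Sum>z\<in>X. cst (of_real (w z)) * a z ^ m) + cst (of_real (w i)) * (a j ^ m - a i ^ m)"
      proof -
        have "j \<noteq> i" using i by blast
        define g where "g z = cst (of_real (w z)) * a z ^ m" for z
        have "sum g X = g i + sum g (X - {i})" using X i by (intro sum.remove) auto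
        also have "sum g (X - {i}) = g j + sum g (X - {i} - {j})"
          using X j \<open>j \<noteq> i\<close> by (intro sum.remove) auto
        finally have "sum g X = g i + (g j + sum g (X - {i} - {j}))" .
        then show ?thesis unfolding g_def by (simp add: algebra_simps)
      qed
      also have "a j ^ m - a i ^ m = (a j - a i) * (\<Sum>k<m. a i ^ (m - Suc k) * a j ^ k)"
        by (rule power_diff_sumr2)
      also have "(\<Sum>z\<in>X. cst (of_real (w z)) * a z ^ m)
          + cst (of_real (w i)) * ((a j - a i) * (\<Sum>k<m. a i ^ (m - Suc k) * a j ^ k))
          = (\<Sum>z\<in>X. cst (of_real (w z)) * a z ^ m)
          + (a j - a i) * (cst (of_real (w i)) * (\<Sum>k<m. a i ^ (m - Suc k) * a j ^ k))"
        by (simp add: algebra_simps)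
      also have "\<dots> \<in> J (int m)"
      proof -
        have "homog p (int m - 1) (\<Sum>k<m. a i ^ (m - Suc k) * a j ^ k)"
        proof (intro homog_sum homog_mult')
          fix k assume "k \<in> {..<m}"
          show "homog p (int (m - Suc k) * 1) (a i ^ (m - Suc k))" using a i by (intro homog_power) auto
          show "homog p (int k * 1) (a j ^ k)" using a j by (intro homog_power) auto
          show "int (m - Suc k) * 1 + int k * 1 = int m - 1" using \<open>k \<in> {..<m}\<close> by auto
        qed
        then show ?thesis unfolding J_def using ps[OF m1] homog_cmult by blast
      qed
      finally show "(\<Sum>z\<in>X - {i}. cst (of_real (w' z)) * a z ^ m) \<in> J (int m)" .
    qed
    then obtain N u r where "a j ^ N = u + (a j - a i) * r" "u \<in> I (int N)" "homog p (int N - 1) r"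
      unfolding J_def by blast
    then show ?thesis by (metis add_diff_cancel_right')
  qed
  \<comment> \<open>Memberships modulo single differences multiply to a membership modulo their
    product, with the exponents added.\<close>
  have prod: "\<exists>N r. homog p (int N - int (card Y)) r \<and> a j ^ N - (\<Prod>z\<in>Y. a j - a z) * r \<in> I (int N)"
    if "finite Y" "Y \<subseteq> X - {j}" for Y
    using that
  proof (induction Y rule: finite_induct)
    case empty
    show ?case using graded_ideal_zero[OF I] homog_one
      by (intro exI[of _ 0] exI[of _ 1]) simp
  next
    case (insert z Y)
    obtain N r where r: "homog p (int N - int (card Y)) r"
      "a j ^ N - (\<Prod>z\<in>Y. a j - a z) * r \<in> I (int N)"
      using insert by auto
    obtain M v where v: "homog p (int M - 1) v" "a j ^ M - (a j - a z) * v \<in> I (int M)"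
      using ex[of z] insert.prems by auto
    have hj: "homog p (int k) (a j ^ k)" for k using homog_power[OF a[OF j]] by simp
    have hY: "homog p (int (card Y)) (\<Prod>z\<in>Y. a j - a z)"
      using insert.hyps(1) insert.prems
    proof (induction Y rule: finite_induct)
      case (insert x F)
      then have "homog p (1 + int (card F)) ((a j - a x) * (\<Prod>z\<in>F. a j - a z))"
        using a j by (intro homog_mult homog_diff) auto
      then show ?case using insert by (simp add: add.commute)
    qed (simp add: homog_one)
    have "a j ^ (N + M) - (\<Prod>z\<in>insert z Y. a j - a z) * (r * v)
        = a j ^ M * (a j ^ N - (\<Prod>z\<in>Y. a j - a z) * r)
          + ((\<Prod>z\<in>Y. a j - a z) * r) * (a j ^ M - (a j - a z) * v)"
    proof -
      have id: "x * y - d * P * (r * v) = y * (x - P * r) + P * r * (y - d * v)"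
        for x y d P :: polyfun by (simp add: algebra_simps)
      show ?thesis unfolding power_add prod.insert[OF insert.hyps] by (rule id)
    qed
    also have "\<dots> \<in> I (int (N + M))"
      using homog_mult'[OF hY r(1), of "int N"]
      by (intro graded_ideal_add[OF I] graded_ideal_mult[OF I hj r(2)] graded_ideal_mult[OF I _ v(2)]) auto
    finally have "a j ^ (N + M) - (\<Prod>z\<in>insert z Y. a j - a z) * (r * v) \<in> I (int (N + M))" .
    moreover have "homog p (int (N + M) - int (card (insert z Y))) (r * v)"
      using insert.hyps by (intro homog_mult'[OF r(1) v(1)]) simp
    ultimately show ?case by blast
  qed
  obtain N r where r: "homog p (int N - int (card (X - {j}))) r"
    "a j ^ N - (\<Prod>z\<in>X - {j}. a j - a z) * r \<in> I (int N)"
    using prod[of "X - {j}"] X by auto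
  have cX: "1 + card (X - {j}) = card X" using card_Suc_Diff1[OF X j] by simp
  define Q where "Q = (\<Prod>z\<in>X - {j}. a j - a z)"
  \<comment> \<open>Here the degree is \<open>card X\<close>, that of the last available power sum.
    The product vanishes at every index other than j.\<close>
  have "(\<Sum>i\<in>X. cst (of_real (w i)) * (a i ^ (1 + 0) * (\<Prod>z\<in>X - {j}. a i - a z)))
      \<in> I (int (1 + 0 + card (X - {j})))"
    using X cX by (intro power_sums_isolate[OF I X a ps]) auto
  also have "(\<Sum>i\<in>X. cst (of_real (w i)) * (a i ^ (1 + 0) * (\<Prod>z\<in>X - {j}. a i - a z)))
      = cst (of_real (w j)) * (a j * Q)"
  proof -
    have "(\<Prod>z\<in>X - {j}. a i - a z) = 0" if "i \<in> X - {j}" for i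
      using X that by (subst prod.remove[of _ i]) auto
    then show ?thesis using X j by (subst sum.remove[of _ j]) (auto simp: Q_def)
  qed
  finally have "cst (of_real (w j)) * (a j * Q) \<in> I (int (card X))"
    using cX by (simp only: add_0_right)
  \<comment> \<open>Division by the positive weight \<open>w j\<close>.\<close>
  then have "cst (of_real (inverse (w j))) * (cst (of_real (w j)) * (a j * Q)) \<in> I (int (card X))"
    by (rule graded_ideal_cmult[OF I])
  also have "cst (of_real (inverse (w j))) * (cst (of_real (w j)) * (a j * Q)) = a j * Q"
    using w[OF j] by (simp add: fun_eq_iff pointwise)
  finally have Q: "a j * Q \<in> I (int (card X))" .
  have "a j ^ Suc N = a j * (a j ^ N - Q * r) + r * (a j * Q)"
    by (simp add: algebra_simps)
  also have "\<dots> \<in> I (int (Suc N))"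
    using cX
    by (intro graded_ideal_add[OF I] graded_ideal_mult[OF I a[OF j]] graded_ideal_mult[OF I r(1) Q])
       (use r(2) in \<open>auto simp: Q_def\<close>)
  finally show ?case by blast
qed

lemma coord_nilpotent_mod_psum_ideal:
  assumes "\<And>i. i \<in> {1..p} \<Longrightarrow> 0 < w i" "j \<in> {1..p}"
  shows "\<exists>N. coord j ^ N \<in> psum_ideal w p p (int N)"
proof (rule nilpotent_if_power_sums_in_ideal[where X = "{1..p}" and w = w and p = p])
  fix m assume "m \<in> {1..card {1..p}}"
  then show "(\<Sum>i\<in>{1..p}. cst (of_real (w i)) * coord i ^ m) \<in> psum_ideal w p p (int m)"
    using psum_mem_psum_ideal[of m p w p] by (simp add: psum_def)
qed (use assms homog_coord in \<open>auto simp: graded_ideal_psum_ideal\<close>)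

section \<open>Syzygies of weighted power sums\<close>

text \<open>That the power sums form a regular sequence is expressed by their syzygies, because this
  form is preserved when a variable is added.\<close>

definition koszul :: "(nat \<Rightarrow> real) \<Rightarrow> nat \<Rightarrow> nat \<Rightarrow> bool" where
  "koszul w p q \<longleftrightarrow>
     (\<forall>s h. (\<forall>l\<in>{1..q}. homog p (s - int l) (h l)) \<longrightarrow> (\<Sum>l=1..q. psum w p l * h l) = 0 \<longrightarrow>
       (\<exists>k. (\<forall>l\<in>{1..q}. \<forall>m\<in>{1..q}. homog p (s - int l - int m) (k l m) \<and> k l m = - k m l) \<and>
            (\<forall>l\<in>{1..q}. h l = (\<Sum>m=1..q. k l m * psum w p m))))"

lemma koszulE:
  assumes "koszul w p q" "\<forall>l\<in>{1..q}. homog p (s - int l) (h l)"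
    and "(\<Sum>l=1..q. psum w p l * h l) = 0"
  obtains k where
    "\<forall>l\<in>{1..q}. \<forall>m\<in>{1..q}. homog p (s - int l - int m) (k l m) \<and> k l m = - k m l"
    "\<forall>l\<in>{1..q}. h l = (\<Sum>m=1..q. k l m * psum w p m)"
proof -
  note K = assms(1)[unfolded koszul_def, THEN spec, THEN spec, THEN mp, THEN mp, OF assms(2,3)]
  then show thesis using that by (elim exE conjE) 
qed

text \<open>Exchanging the two indices turns the double sum into its negative. The values are
  complex numbers, so it is 0 at every point.\<close>

lemma antisymmetric_sum_zero:
  fixes k :: "nat \<Rightarrow> nat \<Rightarrow> polyfun"
  assumes "\<And>l m. l \<in> A \<Longrightarrow> m \<in> A \<Longrightarrow> k l m = - k m l"
  shows "(\<Sum>l\<in>A. b l * (\<Sum>m\<in>A. k l m * b m)) = 0"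
proof
  fix T
  define S where "S = (\<Sum>l\<in>A. \<Sum>m\<in>A. b l T * (k l m T * b m T))"
  have "S = (\<Sum>l\<in>A. \<Sum>m\<in>A. - (b m T * (k m l T * b l T)))"
    unfolding S_def
  proof (intro sum.cong refl)
    fix l m assume lm: "l \<in> A" "m \<in> A"
    have "k l m T = - k m l T" using assms[OF lm] by (metis uminus_apply)
    then show "b l T * (k l m T * b m T) = - (b m T * (k m l T * b l T))" by simp
  qed
  also have "\<dots> = - S"
    unfolding S_def by (subst sum.swap) (simp add: sum_negf)
  finally have "S = 0" by simp
  then show "(\<Sum>l\<in>A. b l * (\<Sum>m\<in>A. k l m * b m)) T = 0 T"
    by (simp add: S_def pointwise sum_distrib_left)
qed

text \<open>At the value 0 of the new variable the h l restrict to a syzygy in p variables, which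
  has a Koszul matrix k. Lifting this relation to p + 1 variables, the error in each h l vanishes
  where the new variable is 0, hence is divisible by it.\<close>

lemma koszul_divide:
  assumes K: "koszul w p q"
    and h: "\<forall>l\<in>{1..q}. homog (Suc p) (s - int l) (h l)"
    and z: "\<And>T. (\<Sum>l=1..q. psum w (Suc p) l * h l) (T(Suc p := 0)) = 0"
  obtains k h' where
    "\<forall>l\<in>{1..q}. \<forall>m\<in>{1..q}. homog p (s - int l - int m) (k l m) \<and> k l m = - k m l"
    "\<forall>l\<in>{1..q}. homog (Suc p) (s - 1 - int l) (h' l)"
    "\<forall>l\<in>{1..q}. h l = (\<Sum>m=1..q. k l m * psum w (Suc p) m) + coord (Suc p) * h' l"
proof -
  have "\<forall>l\<in>{1..q}. \<exists>g0. homog p (s - int l) g0 \<and> (\<forall>T. h l (T(Suc p := 0)) = g0 T)"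
  proof
    fix l assume "l \<in> {1..q}"
    then obtain g0 g1 where g: "homog p (s - int l) g0" "h l = g0 + coord (Suc p) * g1"
      using homog_split[of p "s - int l" "h l"] h by blast
    then have "h l (T(Suc p := 0)) = g0 T" for T
      using homog_cong_outside[OF g(1), of "Suc p" T 0] by (simp add: pointwise)
    then show "\<exists>g0. homog p (s - int l) g0 \<and> (\<forall>T. h l (T(Suc p := 0)) = g0 T)"
      using g(1) by blast
  qed
  then obtain h0 where h0: "\<forall>l\<in>{1..q}. homog p (s - int l) (h0 l)"
    "\<And>l T. l \<in> {1..q} \<Longrightarrow> h l (T(Suc p := 0)) = h0 l T"
    by metis
  have "(\<Sum>l=1..q. psum w p l * h0 l) = 0"
  proof
    fix T
    have "(\<Sum>l=1..q. psum w p l * h0 l) T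
        = (\<Sum>l=1..q. psum w (Suc p) l * h l) (T(Suc p := 0))"
      by (simp add: pointwise h0(2) psum_at_zero)
    then show "(\<Sum>l=1..q. psum w p l * h0 l) T = 0 T" using z by (simp add: pointwise)
  qed
  then obtain k where k:
    "\<forall>l\<in>{1..q}. \<forall>m\<in>{1..q}. homog p (s - int l - int m) (k l m) \<and> k l m = - k m l"
    "\<forall>l\<in>{1..q}. h0 l = (\<Sum>m=1..q. k l m * psum w p m)"
    by (rule koszulE[OF K h0(1)])
  have "\<forall>l\<in>{1..q}. \<exists>h'. homog (Suc p) (s - 1 - int l) h' \<and>
          h l = (\<Sum>m=1..q. k l m * psum w (Suc p) m) + coord (Suc p) * h'"
  proof
    fix l assume l: "l \<in> {1..q}"
    define d where "d = h l - (\<Sum>m=1..q. k l m * psum w (Suc p) m)"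
    have "homog (Suc p) (s - int l) d"
      unfolding d_def
    proof (intro homog_diff homog_sum)
      show "homog (Suc p) (s - int l) (h l)" using h l by blast
      fix m assume m: "m \<in> {1..q}"
      have "homog (Suc p) (s - int l - int m) (k l m)" 
        using k(1) l m by (blast intro: homog_mono[of p _ _ "Suc p", OF _ le_SucI[OF le_refl]])
      from homog_mult'[OF this homog_psum] show "homog (Suc p) (s - int l) (k l m * psum w (Suc p) m)" by simp
    qed
    moreover have "d (T(Suc p := 0)) = 0" for T
    proof -
      have "k l m (T(Suc p := 0)) = k l m T" if "m \<in> {1..q}" for m
      proof -
        have "homog p (s - int l - int m) (k l m)" using k(1) l that by blast
        then show ?thesis by (rule homog_cong_outside) simp
      qed
      then have "d (T(Suc p := 0)) = h0 l T - (\<Sum>m=1..q. k l m * psum w p m) T"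
        by (simp add: d_def pointwise h0(2)[OF l] psum_at_zero)
      then show ?thesis using k(2) l by simp
    qed
    ultimately obtain h' where "homog (Suc p) (s - int l - 1) h'" "d = coord (Suc p) * h'"
      by (rule homog_divide_coord)
    moreover have "h l = (\<Sum>m=1..q. k l m * psum w (Suc p) m) + d" by (simp add: d_def)
    moreover have "s - int l - 1 = s - 1 - int l" by simp
    ultimately show "\<exists>h'. homog (Suc p) (s - 1 - int l) h' \<and>
          h l = (\<Sum>m=1..q. k l m * psum w (Suc p) m) + coord (Suc p) * h'" by metis
  qed
  then obtain h' where "\<forall>l\<in>{1..q}. homog (Suc p) (s - 1 - int l) (h' l) \<and>
          h l = (\<Sum>m=1..q. k l m * psum w (Suc p) m) + coord (Suc p) * h' l"
    by metis
  with k(1) that show thesis by blast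
qed

lemma koszul_sum_eq:
  assumes "\<forall>l\<in>{1..q}. \<forall>m\<in>{1..q}. homog p (s - int l - int m) (k l m) \<and> k l m = - k m l"
    and "\<forall>l\<in>{1..q}. h l = (\<Sum>m=1..q. k l m * psum w p' m) + y * h' l"
  shows "(\<Sum>l=1..q. psum w p' l * h l) = y * (\<Sum>l=1..q. psum w p' l * h' l)"
proof -
  have "(\<Sum>l=1..q. psum w p' l * h l)
      = (\<Sum>l=1..q. psum w p' l * (\<Sum>m=1..q. k l m * psum w p' m)) + y * (\<Sum>l=1..q. psum w p' l * h' l)"
    using assms(2) by (simp add: distrib_left sum.distrib sum_distrib_left algebra_simps)
  also have "(\<Sum>l=1..q. psum w p' l * (\<Sum>m=1..q. k l m * psum w p' m)) = 0"
    using assms(1) by (intro antisymmetric_sum_zero) blast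
  finally show ?thesis by simp
qed

text \<open>The new variable y is not a zero divisor modulo the power sums. The combination
  representing \<open>y * g\<close> vanishes at \<open>y = 0\<close>, so by
  \<open>koszul_divide\<close> it equals y times another combination, its antisymmetric part being
  0; then y is cancelled.\<close>

lemma psum_ideal_coord_cancel:
  assumes K: "koszul w p q" and g: "homog (Suc p) s g"
    and m: "coord (Suc p) * g \<in> psum_ideal w (Suc p) q (s + 1)"
  shows "g \<in> psum_ideal w (Suc p) q s"
proof -
  obtain h where h: "\<forall>l\<in>{1..q}. homog (Suc p) (s + 1 - int l) (h l)"
    "coord (Suc p) * g = (\<Sum>l=1..q. psum w (Suc p) l * h l)"
    using m by (rule psum_idealE)
  have "(\<Sum>l=1..q. psum w (Suc p) l * h l) (T(Suc p := 0)) = 0" for T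
    unfolding h(2)[symmetric] by (simp add: pointwise)
  then obtain k h' where k:
    "\<forall>l\<in>{1..q}. \<forall>m\<in>{1..q}. homog p (s + 1 - int l - int m) (k l m) \<and> k l m = - k m l"
    "\<forall>l\<in>{1..q}. homog (Suc p) (s + 1 - 1 - int l) (h' l)"
    "\<forall>l\<in>{1..q}. h l = (\<Sum>m=1..q. k l m * psum w (Suc p) m) + coord (Suc p) * h' l"
    by (rule koszul_divide[OF K h(1)])
  have h': "(\<Sum>l=1..q. psum w (Suc p) l * h' l) \<in> psum_ideal w (Suc p) q s"
    using k(2) by (intro psum_idealI) simp
  have "coord (Suc p) * (g - (\<Sum>l=1..q. psum w (Suc p) l * h' l)) = 0"
    using h(2) koszul_sum_eq[OF k(1,3)] by (simp add: right_diff_distrib)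
  moreover have "homog (Suc p) s (g - (\<Sum>l=1..q. psum w (Suc p) l * h' l))"
    using g graded_ideal_homog[OF graded_ideal_psum_ideal h'] homog_diff by blast
  ultimately have "g - (\<Sum>l=1..q. psum w (Suc p) l * h' l) = 0"
    by (rule homog_coord_cancel[rotated])
  with h' show ?thesis by simp
qed

lemma psum_ideal_coord_power_cancel:
  assumes K: "koszul w p q"
  shows "homog (Suc p) s g \<Longrightarrow> coord (Suc p) ^ N * g \<in> psum_ideal w (Suc p) q (s + int N) \<Longrightarrow>
    g \<in> psum_ideal w (Suc p) q s"
proof (induction N arbitrary: s g)
  case (Suc N)
  have "homog (Suc p) (s + 1) (coord (Suc p) * g)"
    using homog_mult'[OF homog_coord Suc.prems(1)] by simp
  moreover have "coord (Suc p) ^ N * (coord (Suc p) * g) \<in> psum_ideal w (Suc p) q (s + 1 + int N)"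
    using Suc.prems(2) by (simp add: algebra_simps)
  ultimately have "coord (Suc p) * g \<in> psum_ideal w (Suc p) q (s + 1)" by (rule Suc.IH)
  then show ?case using psum_ideal_coord_cancel[OF K Suc.prems(1)] by blast
qed simp

text \<open>Descent on the degree: a syzygy is a Koszul syzygy plus the new variable times a family
  of degree one less, and this family is again a syzygy because the variable can be
  cancelled.\<close>

lemma koszul_add_variable:
  assumes K: "koszul w p q"
  shows "koszul w (Suc p) q"
proof -
  have *: "\<exists>k. (\<forall>l\<in>{1..q}. \<forall>m\<in>{1..q}. homog (Suc p) (s - int l - int m) (k l m) \<and> k l m = - k m l) \<and>
            (\<forall>l\<in>{1..q}. h l = (\<Sum>m=1..q. k l m * psum w (Suc p) m))"
    if "s \<le> int n" "\<forall>l\<in>{1..q}. homog (Suc p) (s - int l) (h l)"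
      "(\<Sum>l=1..q. psum w (Suc p) l * h l) = 0" for s n h
    using that
  proof (induction n arbitrary: s h)
    \<comment> \<open>For s at most 0 every h l has negative degree, as l starts at 1.\<close>
    case 0
    then have "h l = 0" if "l \<in> {1..q}" for l
      using homog_negative[of "Suc p" "s - int l" "h l"] that by auto
    then show ?case by (intro exI[of _ "\<lambda>_ _. 0"]) (auto simp: homog.zero)
  next
    case (Suc n)
    have z: "(\<Sum>l=1..q. psum w (Suc p) l * h l) (T(Suc p := 0)) = 0" for T
      by (simp only: Suc.prems(3) zero_fun_apply)
    obtain k h' where k:
      "\<forall>l\<in>{1..q}. \<forall>m\<in>{1..q}. homog p (s - int l - int m) (k l m) \<and> k l m = - k m l"
      "\<forall>l\<in>{1..q}. homog (Suc p) (s - 1 - int l) (h' l)"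
      "\<forall>l\<in>{1..q}. h l = (\<Sum>m=1..q. k l m * psum w (Suc p) m) + coord (Suc p) * h' l"
      by (rule koszul_divide[OF K Suc.prems(2) z])
    have "homog (Suc p) (s - 1) (\<Sum>l=1..q. psum w (Suc p) l * h' l)"
      using k(2) by (intro homog_sum homog_psum_mult) simp
    moreover have "coord (Suc p) * (\<Sum>l=1..q. psum w (Suc p) l * h' l) = 0"
      using koszul_sum_eq[OF k(1,3)] Suc.prems(3) by simp
    ultimately have h0: "(\<Sum>l=1..q. psum w (Suc p) l * h' l) = 0"
      by (rule homog_coord_cancel)
    have "s - 1 \<le> int n" using Suc.prems(1) by simp
    from Suc.IH[OF this k(2) h0] obtain k' where k':
      "\<forall>l\<in>{1..q}. \<forall>m\<in>{1..q}. homog (Suc p) (s - 1 - int l - int m) (k' l m) \<and> k' l m = - k' m l"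
      "\<forall>l\<in>{1..q}. h' l = (\<Sum>m=1..q. k' l m * psum w (Suc p) m)"
      by blast
    define K where "K l m = k l m + coord (Suc p) * k' l m" for l m
    have "homog (Suc p) (s - int l - int m) (K l m) \<and> K l m = - K m l"
      if "l \<in> {1..q}" "m \<in> {1..q}" for l m
    proof
      have "homog (Suc p) (s - int l - int m) (k l m)"
        using k(1) that by (blast intro: homog_mono[of p _ _ "Suc p", OF _ le_SucI[OF le_refl]])
      moreover have "homog (Suc p) (s - int l - int m) (coord (Suc p) * k' l m)"
      proof (rule homog_mult'[OF homog_coord])
        show "homog (Suc p) (s - 1 - int l - int m) (k' l m)" using k'(1) that by blast
      qed simp_all
      ultimately show "homog (Suc p) (s - int l - int m) (K l m)"
        unfolding K_def by (rule homog.add)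
      have "k l m = - k m l" "k' l m = - k' m l" using k(1) k'(1) that by blast+
      then show "K l m = - K m l" unfolding K_def
        by (metis minus_add_distrib mult_minus_right)
    qed
    moreover have "h l = (\<Sum>m=1..q. K l m * psum w (Suc p) m)" if "l \<in> {1..q}" for l
    proof -
      have "h l = (\<Sum>m=1..q. k l m * psum w (Suc p) m)
          + coord (Suc p) * (\<Sum>m=1..q. k' l m * psum w (Suc p) m)"
        using k(3) k'(2) that by simp
      then show ?thesis unfolding K_def by (simp add: sum_distrib_left distrib_right sum.distrib mult.assoc)
    qed
    ultimately show ?case by (intro exI[of _ K]) blast
  qed
  show ?thesis
    unfolding koszul_def
  proof (intro allI impI)
    fix s :: int and h :: "nat \<Rightarrow> polyfun"
    assume h: "\<forall>l\<in>{1..q}. homog (Suc p) (s - int l) (h l)" "(\<Sum>l=1..q. psum w (Suc p) l * h l) = 0"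
    have "s \<le> int (nat s)" by simp
    from *[OF this h]
    show "\<exists>k. (\<forall>l\<in>{1..q}. \<forall>m\<in>{1..q}. homog (Suc p) (s - int l - int m) (k l m) \<and> k l m = - k m l) \<and>
            (\<forall>l\<in>{1..q}. h l = (\<Sum>m=1..q. k l m * psum w (Suc p) m))" .
  qed
qed

text \<open>Multiplication by the last power sum is injective modulo the others because some power of
  the last coordinate lies in the ideal that they generate together, and that coordinate can be
  cancelled.\<close>

lemma psum_ideal_psum_cancel:
  assumes K: "koszul w p p" and w: "\<And>i. i \<in> {1..Suc p} \<Longrightarrow> 0 < w i"
    and g: "homog (Suc p) s g"
    and m: "psum w (Suc p) (Suc p) * g \<in> psum_ideal w (Suc p) p (s + int (Suc p))"
  shows "g \<in> psum_ideal w (Suc p) p s"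
proof -
  note I = graded_ideal_psum_ideal[of "Suc p" w p]
  obtain N where "coord (Suc p) ^ N \<in> psum_ideal w (Suc p) (Suc p) (int N)"
    using coord_nilpotent_mod_psum_ideal[of "Suc p" w "Suc p"] w by auto
  then obtain h where h: "\<forall>l\<in>{1..Suc p}. homog (Suc p) (int N - int l) (h l)"
    "coord (Suc p) ^ N = (\<Sum>l=1..Suc p. psum w (Suc p) l * h l)"
    by (rule psum_idealE)
  have 1: "(\<Sum>l=1..p. psum w (Suc p) l * h l) \<in> psum_ideal w (Suc p) p (int N)"
    using h(1) by (intro psum_idealI) auto
  have "coord (Suc p) ^ N * g
      = g * (\<Sum>l=1..p. psum w (Suc p) l * h l) + h (Suc p) * (psum w (Suc p) (Suc p) * g)"
    by (simp add: h(2) algebra_simps)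
  also have "\<dots> \<in> psum_ideal w (Suc p) p (s + int N)"
  proof (intro graded_ideal_add[OF I] graded_ideal_mult[OF I g 1])
    have "homog (Suc p) (int N - int (Suc p)) (h (Suc p))"
      using h(1)[THEN bspec, of "Suc p"] by simp
    then show "h (Suc p) * (psum w (Suc p) (Suc p) * g) \<in> psum_ideal w (Suc p) p (s + int N)"
      by (rule graded_ideal_mult[OF I _ m]) simp
  qed simp
  finally show ?thesis using psum_ideal_coord_power_cancel[OF K g] by blast
qed

text \<open>In a syzygy, the last power sum times the last entry lies in the ideal of the others, so
  by cancellation the last entry itself does, with coefficients m. Adding the last power sum times
  \<open>m l\<close> to the other entries leaves a syzygy of the first p power sums, which is
  Koszul.\<close>

lemma koszul_add_psum:
  assumes K: "koszul w p p" and w: "\<And>i. i \<in> {1..Suc p} \<Longrightarrow> 0 < w i"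
  shows "koszul w (Suc p) (Suc p)"
  unfolding koszul_def
proof (intro allI impI)
  fix s :: int and h :: "nat \<Rightarrow> polyfun"
  let ?f = "psum w (Suc p)" and ?q = "Suc p"
  assume h: "\<forall>l\<in>{1..?q}. homog (Suc p) (s - int l) (h l)"
    and 0: "(\<Sum>l=1..?q. ?f l * h l) = 0"
  note I = graded_ideal_psum_ideal[of "Suc p" w p]
  have hq: "homog (Suc p) (s - int ?q) (h ?q)" using h[THEN bspec, of ?q] by simp
  have "(\<Sum>l=1..p. ?f l * h l) \<in> psum_ideal w (Suc p) p s"
    using h by (intro psum_idealI) auto
  moreover have eq: "?f ?q * h ?q = - (\<Sum>l=1..p. ?f l * h l)"
    using 0 by (simp add: eq_neg_iff_add_eq_0 add.commute)
  ultimately have "?f ?q * h ?q \<in> psum_ideal w (Suc p) p (s - int ?q + int ?q)"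
    using graded_ideal_uminus[OF I] by simp
  then have "h ?q \<in> psum_ideal w (Suc p) p (s - int ?q)"
    by (intro psum_ideal_psum_cancel[OF K w hq])
  then obtain m where m: "\<forall>l\<in>{1..p}. homog (Suc p) (s - int ?q - int l) (m l)" "h ?q = (\<Sum>l=1..p. ?f l * m l)"
    by (rule psum_idealE)
  define h' where "h' l = h l + ?f ?q * m l" for l
  have "homog (Suc p) (s - int l) (h' l)" if "l \<in> {1..p}" for l
  proof -
    have "homog (Suc p) (s - int l - int ?q) (m l)" using m(1) that by (auto simp: algebra_simps)
    then show ?thesis unfolding h'_def using h that by (intro homog.add homog_psum_mult) auto
  qed
  moreover have "(\<Sum>l=1..p. ?f l * h' l) = 0"
  proof -
    have "(\<Sum>l=1..p. ?f l * h' l) = (\<Sum>l=1..p. ?f l * h l) + ?f ?q * (\<Sum>l=1..p. ?f l * m l)"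
      unfolding h'_def by (simp add: distrib_left sum.distrib sum_distrib_left algebra_simps)
    also have "\<dots> = (\<Sum>l=1..?q. ?f l * h l)" using m(2) by simp
    finally show ?thesis using 0 by simp
  qed
  ultimately have "\<forall>l\<in>{1..p}. homog (Suc p) (s - int l) (h' l)" "(\<Sum>l=1..p. ?f l * h' l) = 0"
    by blast+
  then obtain k where k:
    "\<forall>l\<in>{1..p}. \<forall>m\<in>{1..p}. homog (Suc p) (s - int l - int m) (k l m) \<and> k l m = - k m l"
    "\<forall>l\<in>{1..p}. h' l = (\<Sum>m=1..p. k l m * ?f m)"
    by (rule koszulE[OF koszul_add_variable[OF K]])
  \<comment> \<open>The matrix k with a border: the new row m expresses the last entry, and the new
    column \<open>- m\<close> undoes the correction made in h'.\<close>
  define k' where "k' l j =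
    (if l = ?q then if j = ?q then 0 else m j else if j = ?q then - m l else k l j)" for l j
  have "homog (Suc p) (s - int l - int j) (k' l j) \<and> k' l j = - k' j l"
    if "l \<in> {1..?q}" "j \<in> {1..?q}" for l j
  proof -
    have le: "l \<noteq> ?q \<Longrightarrow> l \<in> {1..p}" "j \<noteq> ?q \<Longrightarrow> j \<in> {1..p}" using that by auto
    have mm: "homog (Suc p) (s - int ?q - int i) (m i) \<and> homog (Suc p) (s - int i - int ?q) (- m i)"
      if "i \<in> {1..p}" for i
      using m(1) that homog_uminus by (simp add: algebra_simps)
    consider "l = ?q" "j = ?q" | "l = ?q" "j \<noteq> ?q" | "l \<noteq> ?q" "j = ?q" | "l \<noteq> ?q" "j \<noteq> ?q" by blast
    then show ?thesis
    proof cases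
      case 1 then show ?thesis by (simp add: k'_def homog.zero)
    next
      case 2 then show ?thesis using mm[OF le(2)] by (simp add: k'_def)
    next
      case 3 then show ?thesis using mm[OF le(1)] by (simp add: k'_def)
    next
      case 4
      then show ?thesis using k(1) le unfolding k'_def by (simp only: if_False) blast
    qed
  qed
  moreover have "h l = (\<Sum>j=1..?q. k' l j * ?f j)" if "l \<in> {1..?q}" for l
  proof (cases "l = ?q")
    case True
    have "(\<Sum>j=1..p. k' l j * ?f j) = (\<Sum>j=1..p. ?f j * m j)"
      using True by (intro sum.cong) (auto simp: k'_def mult.commute)
    then show ?thesis using True m(2) by (simp add: k'_def)
  next
    case False
    then have l: "l \<in> {1..p}" using that by auto
    have "(\<Sum>j=1..p. k' l j * ?f j) = (\<Sum>j=1..p. k l j * ?f j)"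
      using False by (intro sum.cong) (auto simp: k'_def)
    also have "\<dots> = h' l" using k(2) l by simp
    finally have "(\<Sum>j=1..?q. k' l j * ?f j) = h' l - m l * ?f ?q"
      using False by (simp add: k'_def)
    then show ?thesis by (simp add: h'_def)
  qed
  ultimately show "\<exists>k. (\<forall>l\<in>{1..?q}. \<forall>m\<in>{1..?q}. homog (Suc p) (s - int l - int m) (k l m) \<and> k l m = - k m l) \<and>
            (\<forall>l\<in>{1..?q}. h l = (\<Sum>m=1..?q. k l m * ?f m))"
    by (intro exI[of _ k']) blast
qed

lemma koszul_psum:
  "(\<And>i. i \<in> {1..p} \<Longrightarrow> 0 < w i) \<Longrightarrow> koszul w p p"
proof (induction p)
  case 0
  then show ?case by (simp add: koszul_def)
next
  case (Suc p)
  then have "koszul w p p" by simp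
  then show ?case using koszul_add_psum Suc.prems by blast
qed

section \<open>Hilbert functions\<close>

interpretation pf: vector_space "\<lambda>c (g::polyfun). cst c * g"
  by standard (simp_all add: fun_eq_iff pointwise algebra_simps)

abbreviation (input) "pfscale \<equiv> \<lambda>c (g::polyfun). cst c * g"

abbreviation homogs :: "nat \<Rightarrow> int \<Rightarrow> polyfun set" where
  "homogs p s \<equiv> {g. homog p s g}"

lemma module_hom_mult: "module_hom pfscale pfscale ((*) f)"
  by standard (simp_all add: algebra_simps)

lemma subspace_homogs: "pf.subspace (homogs p s)"
  unfolding pf.subspace_def by (auto intro: homog.zero homog.add homog_cmult)

lemma subspace_graded_ideal: "graded_ideal p I \<Longrightarrow> pf.subspace (I s)"
  unfolding pf.subspace_def
  using graded_ideal_zero graded_ideal_add graded_ideal_cmult by blast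

lemma psum_ideal_subset_homogs: "psum_ideal w p q s \<subseteq> homogs p s"
  using graded_ideal_homog[OF graded_ideal_psum_ideal] by blast

lemma homog_0: "homog 0 s g \<Longrightarrow> (\<exists>c. g = cst c) \<and> (s \<noteq> 0 \<longrightarrow> g = 0)"
proof (induction rule: homog.induct)
  case (zero s)
  have "(0::polyfun) = cst 0" by (simp add: fun_eq_iff pointwise)
  then show ?case by blast
next
  case (add s g h)
  have "cst c + cst d = cst (c + d)" for c d by (simp add: fun_eq_iff pointwise)
  with add show ?case by fastforce
qed auto

text \<open>Splitting off the last variable lowers either the number of variables or the degree.
  Finite spans make the dimensions below meaningful.\<close>

lemma homogs_finite_span: "\<exists>F. finite F \<and> homogs p s \<subseteq> pf.span F"
proof (induction p arbitrary: s)
  case 0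
  have "homogs 0 s \<subseteq> pf.span {1}"
  proof
    fix g assume "g \<in> homogs 0 s"
    then obtain c where "g = cst c" using homog_0 by blast
    then have "g = cst c * 1" by simp
    then show "g \<in> pf.span {1}" using pf.span_scale[OF pf.span_base[of 1 "{1}"], of c] by simp
  qed
  then show ?case by blast
next
  case (Suc p)
  note IH = Suc.IH
  have "\<exists>F. finite F \<and> homogs (Suc p) s \<subseteq> pf.span F" if "s < int n" for s n
    using that
  proof (induction n arbitrary: s)
    case 0
    then have "homogs (Suc p) s \<subseteq> pf.span {}" using homog_negative by auto
    then show ?case by blast
  next
    case (Suc n)
    obtain F where F: "finite F" "homogs p s \<subseteq> pf.span F" using IH by blast
    obtain F' where F': "finite F'" "homogs (Suc p) (s - 1) \<subseteq> pf.span F'"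
      using Suc.IH[of "s - 1"] Suc.prems by auto
    interpret y: module_hom pfscale pfscale "(*) (coord (Suc p))" by (rule module_hom_mult)
    have "homogs (Suc p) s \<subseteq> pf.span (F \<union> (*) (coord (Suc p)) ` F')"
    proof
      fix g assume "g \<in> homogs (Suc p) s"
      then obtain g0 g1 where g: "homog p s g0" "homog (Suc p) (s - 1) g1" "g = g0 + coord (Suc p) * g1"
        using homog_split by blast
      then have "coord (Suc p) * g1 \<in> pf.span ((*) (coord (Suc p)) ` F')"
        using F' by (simp only: y.span_image) blast
      then show "g \<in> pf.span (F \<union> (*) (coord (Suc p)) ` F')"
        using g F by (auto simp: pf.span_Un)
    qed
    then show ?case using F F' by blast
  qed
  moreover have "s < int (nat (s + 1))" by simp
  ultimately show ?case by blast
qed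

text \<open>The Hilbert function of the polynomial ring in p variables modulo the first q power
  sums. Integer values allow differences, and degrees may be negative.\<close>

definition hilbert :: "(nat \<Rightarrow> real) \<Rightarrow> nat \<Rightarrow> nat \<Rightarrow> int \<Rightarrow> int" where
  "hilbert w p q s = int (pf.dim (homogs p s)) - int (pf.dim (psum_ideal w p q s))"

lemma psum_ideal_complement:
  obtains E where "E \<subseteq> homogs p s" "finite E" "int (card E) = hilbert w p q s"
    "homogs p s \<subseteq> pf.span (psum_ideal w p q s \<union> E)"
proof -
  obtain F where "finite F" "homogs p s \<subseteq> pf.span F" using homogs_finite_span by blast
  from pf.complement_exists[OF subspace_graded_ideal[OF graded_ideal_psum_ideal]
      psum_ideal_subset_homogs this(2,1)]
  obtain E where "E \<subseteq> homogs p s" "finite E"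
    "card E + pf.dim (psum_ideal w p q s) = pf.dim (homogs p s)"
    "homogs p s \<subseteq> pf.span (psum_ideal w p q s \<union> E)"
    by metis
  then show thesis using that[of E] unfolding hilbert_def by simp
qed

lemma hilbert_negative: "s < 0 \<Longrightarrow> hilbert w p q s = 0"
proof -
  assume "s < 0"
  then have "homogs p s = {0}" using homog_negative homog.zero by blast
  moreover have "psum_ideal w p q s = {0}"
    using calculation psum_ideal_subset_homogs[of w p q s] graded_ideal_zero[OF graded_ideal_psum_ideal]
    by blast
  ultimately show ?thesis by (simp add: hilbert_def)
qed

lemma psum_Suc: "psum w (Suc p) l = psum w p l + cst (of_real (w (Suc p))) * coord (Suc p) ^ l"
  by (simp add: psum_def)

text \<open>The power sums in p and in p + 1 variables differ by a multiple of a positive power of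
  the new variable.\<close>

lemma psum_ideal_mod_coord:
  assumes "u \<in> psum_ideal w p q s"
  shows "\<exists>u' v. u' \<in> psum_ideal w (Suc p) q s \<and> homog (Suc p) (s - 1) v \<and> u = u' + coord (Suc p) * v"
proof -
  obtain a where a: "\<forall>l\<in>{1..q}. homog p (s - int l) (a l)" "u = (\<Sum>l=1..q. psum w p l * a l)"
    using assms by (rule psum_idealE)
  have a': "homog (Suc p) (s - int l) (a l)" if "l \<in> {1..q}" for l
    using a(1) that homog_mono[of p _ _ "Suc p"] by auto
  let ?v = "\<Sum>l=1..q. - (cst (of_real (w (Suc p))) * (coord (Suc p) ^ (l - 1) * a l))"
  have "u = (\<Sum>l=1..q. psum w (Suc p) l * a l) + coord (Suc p) * ?v"
    unfolding a(2) sum_distrib_left sum.distrib[symmetric]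
  proof (intro sum.cong refl)
    fix l assume "l \<in> {1..q}"
    then obtain m where "l = Suc m" by (cases l) auto
    then show "psum w p l * a l = psum w (Suc p) l * a l
        + coord (Suc p) * - (cst (of_real (w (Suc p))) * (coord (Suc p) ^ (l - 1) * a l))"
      by (simp add: psum_Suc algebra_simps)
  qed
  moreover have "homog (Suc p) (s - 1) ?v"
  proof (intro homog_sum homog_uminus homog_cmult)
    fix l assume l: "l \<in> {1..q}"
    have "homog (Suc p) (int (l - 1)) (coord (Suc p) ^ (l - 1))"
      using homog_power[OF homog_coord[of "Suc p" "Suc p"], of "l - 1"] by simp
    then show "homog (Suc p) (s - 1) (coord (Suc p) ^ (l - 1) * a l)"
      by (rule homog_mult'[OF _ a'[OF l]]) (use l in auto)
  qed
  ultimately show ?thesis using psum_idealI[of q "Suc p" s a w] a' by blast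
qed

text \<open>By \<open>homog_split\<close> the quotient in p + 1 variables is spanned in degree s by
  representatives from the quotient in p variables, together with the new variable times
  representatives of degree \<open>s - 1\<close>.\<close>

lemma hilbert_add_variable:
  "hilbert w (Suc p) q s \<le> hilbert w (Suc p) q (s - 1) + hilbert w p q s"
proof -
  let ?y = "coord (Suc p)" and ?I = "psum_ideal w (Suc p) q"
  note I = graded_ideal_psum_ideal[of "Suc p" w q]
  obtain E where E: "E \<subseteq> homogs p s" "finite E" "int (card E) = hilbert w p q s"
    "homogs p s \<subseteq> pf.span (psum_ideal w p q s \<union> E)"
    by (rule psum_ideal_complement)
  obtain E' where E': "E' \<subseteq> homogs (Suc p) (s - 1)" "finite E'"
    "int (card E') = hilbert w (Suc p) q (s - 1)"
    "homogs (Suc p) (s - 1) \<subseteq> pf.span (?I (s - 1) \<union> E')"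
    by (rule psum_ideal_complement)
  interpret y: module_hom pfscale pfscale "(*) ?y" by (rule module_hom_mult)
  let ?S = "pf.span (?I s \<union> (E \<union> (*) ?y ` E'))"
  have yS: "?y * g \<in> ?S" if g: "homog (Suc p) (s - 1) g" for g
  proof -
    have "g \<in> pf.span (?I (s - 1) \<union> E')" using E'(4) g by blast
    then have "?y * g \<in> pf.span ((*) ?y ` (?I (s - 1) \<union> E'))" by (simp only: y.span_image) blast
    moreover have "(*) ?y ` (?I (s - 1) \<union> E') \<subseteq> ?I s \<union> (E \<union> (*) ?y ` E')"
      using graded_ideal_mult[OF I homog_coord, of "Suc p" _ "s - 1" s] by auto
    ultimately show ?thesis using pf.span_mono by blast
  qed
  have "homogs (Suc p) s \<subseteq> ?S"
  proof
    fix g assume "g \<in> homogs (Suc p) s"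
    then obtain g0 g1 where g: "homog p s g0" "homog (Suc p) (s - 1) g1" "g = g0 + ?y * g1"
      using homog_split by blast
    have "g0 \<in> pf.span (psum_ideal w p q s \<union> E)" using g(1) E(4) by blast
    moreover have "pf.span (psum_ideal w p q s) = psum_ideal w p q s"
      by (simp add: subspace_graded_ideal[OF graded_ideal_psum_ideal])
    ultimately obtain u e where ue: "u \<in> psum_ideal w p q s" "e \<in> pf.span E" "g0 = u + e"
      unfolding pf.span_Un by auto
    obtain u' v where u': "u' \<in> ?I s" "homog (Suc p) (s - 1) v" "u = u' + ?y * v"
      using psum_ideal_mod_coord[OF ue(1)] by blast
    have "e \<in> ?S" using ue(2) pf.span_mono[of E "?I s \<union> (E \<union> (*) ?y ` E')"] by blast
    moreover have "u' \<in> ?S" using u'(1) pf.span_base by blast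
    moreover have "g = u' + (?y * v + (e + ?y * g1))" by (simp add: g(3) ue(3) u'(3) algebra_simps)
    ultimately show "g \<in> ?S" using yS[OF u'(2)] yS[OF g(2)] pf.span_add by metis
  qed
  moreover obtain F where "finite F" "homogs (Suc p) s \<subseteq> pf.span F"
    using homogs_finite_span by blast
  ultimately have "pf.dim (homogs (Suc p) s) \<le> pf.dim (?I s) + card (E \<union> (*) ?y ` E')"
    using E(2) E'(2) psum_ideal_subset_homogs[of w "Suc p" q s]
    by (intro pf.dim_le_dim_plus_card[where F = F]) auto
  also have "card (E \<union> (*) ?y ` E') \<le> card E + card E'"
    using card_Un_le[of E "(*) ?y ` E'"] card_image_le[OF E'(2), of "(*) ?y"] by linarith
  finally show ?thesis using E(3) E'(3) unfolding hilbert_def by linarith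
qed

text \<open>Multiplication by the new power sum embeds the quotient in degree
  \<open>s - (p + 1)\<close> into the new ideal modulo the old one in degree s, so the ideal grows
  at least by that dimension.\<close>

lemma hilbert_add_psum:
  assumes w: "\<And>i. i \<in> {1..Suc p} \<Longrightarrow> 0 < w i"
  shows "hilbert w (Suc p) (Suc p) s \<le> hilbert w (Suc p) p s - hilbert w (Suc p) p (s - int (Suc p))"
proof -
  let ?W1 = "homogs (Suc p) (s - int (Suc p))" and ?U1 = "psum_ideal w (Suc p) p (s - int (Suc p))"
  let ?f = "psum w (Suc p) (Suc p)"
  have K: "koszul w p p" using w by (intro koszul_psum) auto
  obtain F where F: "finite F" "homogs (Suc p) s \<subseteq> pf.span F"
    using homogs_finite_span by blast
  obtain F1 where F1: "finite F1" "?W1 \<subseteq> pf.span F1"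
    using homogs_finite_span by blast
  note I = graded_ideal_psum_ideal
  have "pf.dim ?W1 + pf.dim (psum_ideal w (Suc p) p s)
      \<le> pf.dim (psum_ideal w (Suc p) (Suc p) s) + pf.dim ?U1"
  proof (rule pf.dim_le_codim_injective_mod[OF subspace_graded_ideal[OF I] _ _ F(1)
        subspace_graded_ideal[OF I] psum_ideal_subset_homogs F1(2,1) subspace_homogs module_hom_mult])
    show "psum_ideal w (Suc p) p s \<subseteq> psum_ideal w (Suc p) (Suc p) s"
    proof
      fix g assume "g \<in> psum_ideal w (Suc p) p s"
      then obtain h where h: "\<forall>l\<in>{1..p}. homog (Suc p) (s - int l) (h l)"
        "g = (\<Sum>l=1..p. psum w (Suc p) l * h l)" by (rule psum_idealE)
      have "(\<Sum>l=1..Suc p. psum w (Suc p) l * (if l = Suc p then 0 else h l)) \<in> psum_ideal w (Suc p) (Suc p) s"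
        using h(1) by (intro psum_idealI) (auto simp: homog.zero)
      also have "(\<Sum>l=1..Suc p. psum w (Suc p) l * (if l = Suc p then 0 else h l)) = g"
        by (simp add: h(2))
      finally show "g \<in> psum_ideal w (Suc p) (Suc p) s" .
    qed
    show "psum_ideal w (Suc p) (Suc p) s \<subseteq> pf.span F"
      using F(2) psum_ideal_subset_homogs by blast
    show "(*) ?f ` ?W1 \<subseteq> psum_ideal w (Suc p) (Suc p) s"
    proof clarify
      fix g assume "homog (Suc p) (s - int (Suc p)) g"
      then have "g * ?f \<in> psum_ideal w (Suc p) (Suc p) s"
        by (rule graded_ideal_mult[OF I _ psum_mem_psum_ideal]) auto
      then show "?f * g \<in> psum_ideal w (Suc p) (Suc p) s" by (simp add: mult.commute)
    qed
    show "g \<in> ?U1" if "g \<in> ?W1" "?f * g \<in> psum_ideal w (Suc p) p s" for g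
    proof (rule psum_ideal_psum_cancel[OF K w])
      show "homog (Suc p) (s - int (Suc p)) g" using that(1) by simp
      show "?f * g \<in> psum_ideal w (Suc p) p (s - int (Suc p) + int (Suc p))"
        using that(2) by simp
    qed
  qed
  then show ?thesis unfolding hilbert_def by linarith
qed

text \<open>Differences with lag \<open>Suc c\<close> telescope to the last \<open>Suc c\<close>
  values, as G vanishes at negative arguments.\<close>

lemma sum_lag_telescope:
  fixes G :: "int \<Rightarrow> int"
  assumes "\<And>s. s < 0 \<Longrightarrow> G s = 0"
  shows "(\<Sum>s<M. G (int s) - G (int s - int (Suc c))) = (\<Sum>j<Suc c. G (int M - 1 - int j))"
proof (induction M)
  case 0
  show ?case using assms by simp
next
  case (Suc M)
  have "(\<Sum>j<Suc c. G (int (Suc M) - 1 - int j)) + G (int M - int (Suc c))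
      = (\<Sum>j<Suc (Suc c). G (int M - int j))"
    by (simp add: algebra_simps)
  also have "\<dots> = G (int M) + (\<Sum>j<Suc c. G (int M - 1 - int j))"
    by (subst sum.lessThan_Suc_shift) (simp add: algebra_simps)
  finally show ?case using Suc.IH by simp
qed

text \<open>Adding a variable bounds each value of the new Hilbert function by a partial sum of the
  old one, hence by p factorial. Adding the power sum of degree p + 1 replaces the values by
  differences with lag p + 1, whose sum consists of p + 1 such values.\<close>

lemma sum_hilbert_le:
  "(\<And>i. i \<in> {1..p} \<Longrightarrow> 0 < w i) \<Longrightarrow> (\<Sum>s<M. hilbert w p p (int s)) \<le> fact p"
proof (induction p arbitrary: M)
  case 0
  have "hilbert w 0 0 (int s) \<le> (if s = 0 then 1 else 0)" for s
  proof -
    have "pf.dim (homogs 0 (int s)) \<le> card (if s = 0 then {1::polyfun} else {})"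
    proof (rule pf.dim_le_card)
      show "homogs 0 (int s) \<subseteq> pf.span (if s = 0 then {1} else {})"
      proof
        fix g assume g: "g \<in> homogs 0 (int s)"
        then obtain c where "g = cst c" using homog_0 by blast
        then have "g = cst c * 1" by simp
        then show "g \<in> pf.span (if s = 0 then {1} else {})"
          using pf.span_scale[OF pf.span_base[of 1 "{1}"], of c] homog_0 g by auto
      qed
    qed simp
    then show ?thesis unfolding hilbert_def by (auto split: if_splits)
  qed
  then have "(\<Sum>s<M. hilbert w 0 0 (int s)) \<le> (\<Sum>s<M. if s = 0 then 1 else 0)"
    by (intro sum_mono)
  also have "\<dots> \<le> 1" by (simp add: sum.delta)
  finally show ?case by simp
next
  case (Suc p)
  have IH: "(\<Sum>s<M. hilbert w p p (int s)) \<le> fact p" for M using Suc by simp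
  have "hilbert w (Suc p) p (int n) \<le> (\<Sum>s<Suc n. hilbert w p p (int s))" for n
  proof (induction n)
    case 0
    then show ?case using hilbert_add_variable[of w p p 0] hilbert_negative[of "-1"] by simp
  next
    case (Suc n)
    then show ?case using hilbert_add_variable[of w p p "int (Suc n)"] by simp
  qed
  then have "hilbert w (Suc p) p (int n) \<le> fact p" for n
    using IH order_trans by blast
  then have B: "hilbert w (Suc p) p s \<le> fact p" for s
    using hilbert_negative[of s w "Suc p" p] by (cases "s < 0") (auto simp: not_less dest: zero_le_imp_eq_int)
  have "(\<Sum>s<M. hilbert w (Suc p) (Suc p) (int s))
      \<le> (\<Sum>s<M. hilbert w (Suc p) p (int s) - hilbert w (Suc p) p (int s - int (Suc p)))"
    using Suc.prems by (intro sum_mono hilbert_add_psum)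
  also have "\<dots> = (\<Sum>j<Suc p. hilbert w (Suc p) p (int M - 1 - int j))"
    using hilbert_negative by (intro sum_lag_telescope)
  also have "\<dots> \<le> (\<Sum>j<Suc p. fact p)" using B by (intro sum_mono)
  finally show ?case by simp
qed

section \<open>Fibres of the weighted power sum map\<close>

text \<open>The components are given for all degrees and are 0 from M on, so that the bound can be
  raised while f stays the same.\<close>

definition polynomial_of_degree_less :: "nat \<Rightarrow> nat \<Rightarrow> polyfun \<Rightarrow> bool" where
  "polynomial_of_degree_less p M g \<longleftrightarrow>
     (\<exists>f. (\<forall>s. homog p (int s) (f s)) \<and> (\<forall>s\<ge>M. f s = 0) \<and> g = (\<Sum>s<M. f s))"

lemma polynomial_of_degree_less_mono:
  "polynomial_of_degree_less p M g \<Longrightarrow> M \<le> M' \<Longrightarrow> polynomial_of_degree_less p M' g"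
proof -
  assume "polynomial_of_degree_less p M g" and le: "M \<le> M'"
  then obtain f where f: "\<forall>s. homog p (int s) (f s)" "\<forall>s\<ge>M. f s = 0" "g = (\<Sum>s<M. f s)"
    unfolding polynomial_of_degree_less_def by blast
  have "(\<Sum>s<M. f s) = (\<Sum>s<M'. f s)"
    using f(2) le by (intro sum.mono_neutral_left) auto
  then show ?thesis unfolding polynomial_of_degree_less_def using f le by auto
qed

lemma polynomial_mult_linear:
  assumes g: "polynomial_of_degree_less p M g" and i: "i \<in> {1..p}"
  shows "polynomial_of_degree_less p (Suc M) (cst a * ((coord i - cst b) * g))"
proof -
  obtain f where f: "\<forall>s. homog p (int s) (f s)" "\<forall>s\<ge>M. f s = 0" "g = (\<Sum>s<M. f s)"
    using g unfolding polynomial_of_degree_less_def by blast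
  define f' where "f' s = cst a * ((case s of 0 \<Rightarrow> 0 | Suc r \<Rightarrow> coord i * f r) - cst b * f s)" for s
  have "homog p (int s) (f' s)" for s
  proof (cases s)
    case 0
    have "homog p (int 0) (f 0)" using f(1) by blast
    then show ?thesis unfolding f'_def 0 nat.case
      by (intro homog_cmult homog_diff homog.zero)
  next
    case (Suc r)
    have "homog p (int r + 1) (coord i * f r)" using f(1) i by (intro homog.coord_mult) auto
    then have h: "homog p (int s) (coord i * f r)" using Suc by (simp add: add.commute)
    have "f' s = cst a * (coord i * f r - cst b * f s)" by (simp only: f'_def Suc nat.case)
    moreover have "homog p (int s) (f s)" using f(1) by blast
    ultimately show ?thesis using homog_cmult homog_diff h by presburger
  qed
  moreover have "f' s = 0" if "s \<ge> Suc M" for s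
    using that f(2) unfolding f'_def by (cases s) auto
  moreover have "cst a * ((coord i - cst b) * g) = (\<Sum>s<Suc M. f' s)"
  proof -
    have "(\<Sum>s<Suc M. f' s) = cst a * ((\<Sum>s<Suc M. case s of 0 \<Rightarrow> 0 | Suc r \<Rightarrow> coord i * f r)
        - cst b * (\<Sum>s<Suc M. f s))"
      unfolding f'_def by (simp only: sum_distrib_left sum_subtractf right_diff_distrib)
    also have "(\<Sum>s<Suc M. case s of 0 \<Rightarrow> 0 | Suc r \<Rightarrow> coord i * f r) = coord i * g"
      by (subst sum.lessThan_Suc_shift) (simp add: f(3) sum_distrib_left)
    also have "(\<Sum>s<Suc M. f s) = g" using f(2,3) by simp
    finally show ?thesis by (simp only: left_diff_distrib)
  qed
  ultimately show ?thesis unfolding polynomial_of_degree_less_def by blast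
qed

text \<open>A product of normalised linear factors, one for each point of S. Distinct extensional
  functions differ at some coordinate in \<open>{1..p}\<close>, and a factor in that coordinate
  separates them.\<close>

lemma polynomial_separates_point:
  assumes "finite S" "\<tau> \<notin> S" "\<tau> \<in> {1..p} \<rightarrow>\<^sub>E UNIV" "S \<subseteq> {1..p} \<rightarrow>\<^sub>E UNIV"
  shows "\<exists>M g. polynomial_of_degree_less p M g \<and> g \<tau> = 1 \<and> (\<forall>\<sigma>\<in>S. g \<sigma> = 0)"
  using assms
proof (induction S rule: finite_induct)
  case empty
  have "polynomial_of_degree_less p 1 1"
    unfolding polynomial_of_degree_less_def
    by (intro exI[of _ "\<lambda>s. if s = 0 then 1 else 0"]) (auto simp: homog_one homog.zero)
  moreover have "(1::polyfun) \<tau> = 1" by (simp add: pointwise)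
  ultimately show ?case by blast
next
  case (insert \<sigma> S)
  then obtain M g where g: "polynomial_of_degree_less p M g" "g \<tau> = 1" "\<forall>\<sigma>\<in>S. g \<sigma> = 0"
    by auto
  have "\<tau> \<noteq> \<sigma>" using insert by blast
  then obtain i where i: "i \<in> {1..p}" "\<tau> i \<noteq> \<sigma> i"
    using PiE_ext[of \<tau> "{1..p}" "\<lambda>_. UNIV" \<sigma>] insert.prems by blast
  let ?g = "cst (1 / (\<tau> i - \<sigma> i)) * ((coord i - cst (\<sigma> i)) * g)"
  have "polynomial_of_degree_less p (Suc M) ?g" using g(1) i(1) by (rule polynomial_mult_linear)
  moreover have "?g \<tau> = 1" "\<forall>\<rho>\<in>insert \<sigma> S. ?g \<rho> = 0"
    using g i by (auto simp: pointwise)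
  ultimately show ?case by blast
qed

text \<open>On a fibre of the power sum map every polynomial function agrees with a combination of
  representatives of the quotient by the homogeneous ideal of the power sums.\<close>

lemma card_finite_subset_fibre_le:
  assumes w: "\<And>i. i \<in> {1..p} \<Longrightarrow> 0 < w i"
    and S: "finite S" "S \<subseteq> {1..p} \<rightarrow>\<^sub>E UNIV"
    and c: "\<And>T l. T \<in> S \<Longrightarrow> l \<in> {1..p} \<Longrightarrow> psum w p l T = c l"
  shows "card S \<le> fact p"
proof -
  have "\<exists>E. E \<subseteq> homogs p s \<and> finite E \<and> int (card E) = hilbert w p p s \<and>
      homogs p s \<subseteq> pf.span (psum_ideal w p p s \<union> E)" for s
    using psum_ideal_complement[of p s w p] by metis
  then obtain E where E: "\<And>s. finite (E s)" "\<And>s. int (card (E s)) = hilbert w p p s"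
    "\<And>s. homogs p s \<subseteq> pf.span (psum_ideal w p p s \<union> E s)"
    by metis
  have "\<forall>\<tau>\<in>S. \<exists>M g. polynomial_of_degree_less p M g \<and> g \<tau> = 1 \<and> (\<forall>\<sigma>\<in>S - {\<tau>}. g \<sigma> = 0)"
    using S by (intro ballI polynomial_separates_point) auto
  then obtain M g where g: "\<And>\<tau>. \<tau> \<in> S \<Longrightarrow> polynomial_of_degree_less p (M \<tau>) (g \<tau>)"
    "\<And>\<tau>. \<tau> \<in> S \<Longrightarrow> g \<tau> \<tau> = 1" "\<And>\<tau> \<sigma>. \<tau> \<in> S \<Longrightarrow> \<sigma> \<in> S \<Longrightarrow> \<sigma> \<noteq> \<tau> \<Longrightarrow> g \<tau> \<sigma> = 0"
    by (metis Diff_iff singletonD)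
  define N where "N = Max (insert 0 (M ` S))"
  have N: "M \<tau> \<le> N" if "\<tau> \<in> S" for \<tau> unfolding N_def using that S(1) by (intro Max_ge) auto
  define EN where "EN = (\<Union>s<N. E (int s))"
  have fEN: "finite EN" unfolding EN_def using E(1) by blast
  \<comment> \<open>Strong induction on the degree: on S each power sum is the constant
    \<open>c l\<close>, so the ideal part of h becomes a combination of forms of degree
    \<open>s - l\<close>, lower because l is at least 1.\<close>
  have reduce: "\<exists>e\<in>pf.span EN. \<forall>T\<in>S. h T = e T" if "homog p (int s) h" "s < N" for s h
    using that
  proof (induction s arbitrary: h rule: less_induct)
    case (less s h)
    have "h \<in> pf.span (psum_ideal w p p (int s) \<union> E (int s))" using E(3) less.prems(1) by blast
    moreover have "pf.span (psum_ideal w p p (int s)) = psum_ideal w p p (int s)"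
      by (simp add: subspace_graded_ideal[OF graded_ideal_psum_ideal])
    ultimately obtain u e where ue: "u \<in> psum_ideal w p p (int s)" "e \<in> pf.span (E (int s))" "h = u + e"
      unfolding pf.span_Un by auto
    have e: "e \<in> pf.span EN"
      using ue(2) less.prems(2) pf.span_mono[of "E (int s)" EN] unfolding EN_def by blast
    obtain a where a: "\<forall>l\<in>{1..p}. homog p (int s - int l) (a l)" "u = (\<Sum>l=1..p. psum w p l * a l)"
      using ue(1) by (rule psum_idealE)
    have "\<exists>b\<in>pf.span EN. \<forall>T\<in>S. a l T = b T" if l: "l \<in> {1..p}" for l
    proof (cases "l \<le> s")
      case True
      then have "homog p (int (s - l)) (a l)" using a(1) l by (simp add: of_nat_diff)
      then show ?thesis using less.IH[of "s - l" "a l"] l less.prems(2) True by auto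
    next
      case False
      then have "a l = 0" using a(1) l homog_negative[of p "int s - int l" "a l"] by auto
      then show ?thesis using pf.span_zero[of EN] by (intro bexI[of _ 0]) simp_all
    qed
    then obtain b where b: "\<And>l. l \<in> {1..p} \<Longrightarrow> b l \<in> pf.span EN"
      "\<And>l T. l \<in> {1..p} \<Longrightarrow> T \<in> S \<Longrightarrow> a l T = b l T"
      by metis
    have "(\<Sum>l=1..p. cst (c l) * b l) + e \<in> pf.span EN"
      using b(1) e by (intro pf.span_add pf.span_sum pf.span_scale) auto
    moreover have "h T = ((\<Sum>l=1..p. cst (c l) * b l) + e) T" if "T \<in> S" for T
    proof -
      have "h T = (\<Sum>l=1..p. psum w p l T * a l T) + e T" by (simp add: ue(3) a(2) pointwise)
      also have "(\<Sum>l=1..p. psum w p l T * a l T) = (\<Sum>l=1..p. c l * b l T)"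
        using c[OF that] b(2)[OF _ that] by (intro sum.cong) auto
      finally show ?thesis by (simp add: pointwise)
    qed
    ultimately show ?case by blast
  qed
  \<comment> \<open>Restriction to S, and the indicators of points. Interpolation puts the
    indicators of all points of S into the span of the restrictions of EN; they are independent, so
    S has at most as many elements as EN.\<close>
  define \<rho> :: "polyfun \<Rightarrow> polyfun" where "\<rho> h = (\<lambda>T. if T \<in> S then h T else 0)" for h
  define \<delta> :: "(nat \<Rightarrow> complex) \<Rightarrow> polyfun" where "\<delta> \<tau> = (\<lambda>T. if T = \<tau> then 1 else 0)" for \<tau>
  interpret \<rho>: module_hom pfscale pfscale \<rho>
    by standard (simp_all add: \<rho>_def fun_eq_iff pointwise)
  have "\<delta> \<tau> \<in> pf.span (\<rho> ` EN)" if \<tau>: "\<tau> \<in> S" for \<tau>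
  proof -
    obtain f where f: "\<forall>s. homog p (int s) (f s)" "g \<tau> = (\<Sum>s<N. f s)"
      using polynomial_of_degree_less_mono[OF g(1)[OF \<tau>] N[OF \<tau>]]
      unfolding polynomial_of_degree_less_def by blast
    have "\<forall>s\<in>{..<N}. \<exists>e\<in>pf.span EN. \<forall>T\<in>S. f s T = e T" using reduce f(1) by blast
    then obtain e where e: "\<And>s. s < N \<Longrightarrow> e s \<in> pf.span EN" "\<And>s T. s < N \<Longrightarrow> T \<in> S \<Longrightarrow> f s T = e s T"
      by (metis lessThan_iff)
    have "\<delta> \<tau> = \<rho> (\<Sum>s<N. e s)"
    proof
      fix T
      show "\<delta> \<tau> T = \<rho> (\<Sum>s<N. e s) T"
      proof (cases "T \<in> S")
        case True
        have "\<delta> \<tau> T = g \<tau> T" using g(2,3) \<tau> True by (auto simp: \<delta>_def)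
        also have "\<dots> = (\<Sum>s<N. e s T)" using e(2) True by (simp add: f(2) pointwise)
        finally show ?thesis using True by (simp add: \<rho>_def pointwise)
      next
        case False
        then show ?thesis using \<tau> by (auto simp: \<delta>_def \<rho>_def)
      qed
    qed
    moreover have "(\<Sum>s<N. e s) \<in> pf.span EN" using e(1) by (intro pf.span_sum) auto
    ultimately show ?thesis using \<rho>.span_image by blast
  qed
  then have sub: "\<delta> ` S \<subseteq> pf.span (\<rho> ` EN)" by blast
  have inj: "inj_on \<delta> S"
    by (rule inj_onI) (metis \<delta>_def zero_neq_one)
  have "pf.independent (\<delta> ` S)"
  proof
    assume "pf.dependent (\<delta> ` S)"
    then obtain a x where x: "x \<in> \<delta> ` S" "a x \<noteq> 0" and 0: "(\<Sum>x\<in>\<delta> ` S. cst (a x) * x) = 0"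
      using pf.dependent_finite[OF finite_imageI[OF S(1)]] by blast
    obtain \<tau> where \<tau>: "\<tau> \<in> S" "x = \<delta> \<tau>" using x(1) by blast
    have "(\<Sum>\<sigma>\<in>S. cst (a (\<delta> \<sigma>)) * \<delta> \<sigma>) = 0"
      using 0 by (simp only: sum.reindex[OF inj] o_def)
    then have z: "(\<Sum>\<sigma>\<in>S. cst (a (\<delta> \<sigma>)) * \<delta> \<sigma>) \<tau> = 0 \<tau>" by (rule fun_cong)
    have "(\<Sum>\<sigma>\<in>S. cst (a (\<delta> \<sigma>)) * \<delta> \<sigma>) \<tau> = (\<Sum>\<sigma>\<in>S. if \<sigma> = \<tau> then a (\<delta> \<tau>) else 0)"
      unfolding sum_fun_apply times_fun_apply cst_apply
      by (intro sum.cong) (auto simp: \<delta>_def)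
    also have "\<dots> = a x"
      unfolding \<tau>(2) sum.delta[OF S(1)] by (simp only: \<tau>(1) if_True)
    finally show False using x(2) z by (simp only: zero_fun_apply)
  qed
  then have "card (\<delta> ` S) \<le> card (\<rho> ` EN)"
    using pf.independent_span_bound[OF finite_imageI[OF fEN] _ sub] by blast
  also have "\<dots> \<le> card EN" by (rule card_image_le[OF fEN])
  also have "card EN \<le> (\<Sum>s<N. card (E (int s)))"
    unfolding EN_def by (rule card_UN_le) simp
  finally have "int (card S) \<le> (\<Sum>s<N. int (card (E (int s))))"
    by (simp add: card_image[OF inj] flip: of_nat_sum)
  also have "\<dots> \<le> fact p" using sum_hilbert_le[OF w] E(2) by simp
  finally show ?thesis by (metis of_nat_fact of_nat_le_iff)
qed

text \<open>A uniform bound on the finite subsets of a fibre makes the fibre finite with the same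
  bound.\<close>

lemma finite_card_weighted_power_sum_fibre:
  fixes w :: "nat \<Rightarrow> real" and c :: "nat \<Rightarrow> complex"
  assumes w: "\<And>i. i \<in> {1..p} \<Longrightarrow> 0 < w i"
  defines "Z \<equiv> {T \<in> {1..p} \<rightarrow>\<^sub>E UNIV. \<forall>l\<in>{1..p}. (\<Sum>j=1..p. complex_of_real (w j) * T j ^ l) = c l}"
  shows "finite Z" "card Z \<le> fact p"
proof -
  have *: "card S \<le> fact p" if "S \<subseteq> Z" "finite S" for S
    using that unfolding Z_def
    by (intro card_finite_subset_fibre_le[OF w, where c = c]) (auto simp: psum_apply)
  show "finite Z"
  proof (rule ccontr)
    assume "infinite Z"
    then obtain S where "finite S" "card S = Suc (fact p)" "S \<subseteq> Z"
      using infinite_arbitrarily_large by blast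
    then have "Suc (fact p) \<le> fact p" using * by metis
    then show False by simp
  qed
  then show "card Z \<le> fact p" using * by blast
qed

section \<open>Orthogonal projections and moments of tight fusion frames\<close>

lemma orth_proj_eqI:
  assumes "subspace V" "u \<in> V" "\<And>v. v \<in> V \<Longrightarrow> orthogonal (y - u) v"
  shows "orth_proj V y = u"
  unfolding orth_proj_def
proof (rule the_equality)
  fix u' assume u': "u' \<in> V \<and> (\<forall>v\<in>V. orthogonal (y - u') v)"
  have "u - u' \<in> V" using assms u' by (simp add: subspace_diff)
  then have "(y - u') \<bullet> (u - u') = 0" "(y - u) \<bullet> (u - u') = 0"
    using u' assms(3) by (auto simp: orthogonal_def)
  then have "(u - u') \<bullet> (u - u') = 0" by (simp add: inner_diff_left inner_diff_right)
  then show "u' = u" by simp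
qed (use assms in blast)

text \<open>The expansion in an orthonormal basis shows that \<open>orth_proj V\<close> is linear,
  so that its matrix represents it.\<close>

lemma proj_mat_orthonormal_basis:
  fixes V :: "(real^'d) set"
  assumes "V \<in> grassmannian k"
  obtains B where "finite B" "card B = k" "B \<subseteq> V" "\<forall>b\<in>B. norm b = 1"
    "pairwise orthogonal B" "\<forall>y. proj_mat V *v y = (\<Sum>b\<in>B. (b \<bullet> y) *\<^sub>R b)"
    "\<forall>y. orth_proj V y = (\<Sum>b\<in>B. (b \<bullet> y) *\<^sub>R b)"
proof -
  have V: "subspace V" "dim V = k" using assms by (auto simp: grassmannian_def)
  obtain B where B: "B \<subseteq> V" "pairwise orthogonal B" "\<And>b. b \<in> B \<Longrightarrow> norm b = 1"
    "independent B" "card B = dim V" "span B = V"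
    using orthonormal_basis_subspace[OF V(1)] by metis
  have fB: "finite B" using B(4) independent_bound by blast
  have op: "orth_proj V y = (\<Sum>b\<in>B. (b \<bullet> y) *\<^sub>R b)" for y
  proof (rule orth_proj_eqI[OF V(1)])
    show "(\<Sum>b\<in>B. (b \<bullet> y) *\<^sub>R b) \<in> V"
      using B(1) by (intro subspace_sum[OF V(1)] subspace_scale[OF V(1)]) auto
    fix v assume "v \<in> V"
    then have "v \<in> span B" using B(6) by simp
    then show "orthogonal (y - (\<Sum>b\<in>B. (b \<bullet> y) *\<^sub>R b)) v"
    proof (rule orthogonal_to_span)
      fix c assume c: "c \<in> B"
      have "(\<Sum>b\<in>B. (b \<bullet> y) *\<^sub>R b) \<bullet> c = (\<Sum>b\<in>B. if b = c then b \<bullet> y else 0)"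
        unfolding inner_sum_left
      proof (intro sum.cong refl)
        fix b assume b: "b \<in> B"
        show "((b \<bullet> y) *\<^sub>R b) \<bullet> c = (if b = c then b \<bullet> y else 0)"
          using B(2) b c B(3)[OF c] by (auto simp: pairwise_def orthogonal_def norm_eq_1)
      qed
      also have "\<dots> = c \<bullet> y" using fB c by simp
      finally show "orthogonal (y - (\<Sum>b\<in>B. (b \<bullet> y) *\<^sub>R b)) c"
        by (simp add: orthogonal_def inner_diff_left inner_commute[of c y])
    qed
  qed
  have "linear (\<lambda>y. \<Sum>b\<in>B. (b \<bullet> y) *\<^sub>R b)"
    by (intro linear_compose_sum ballI linearI)
       (simp_all add: inner_add_right scaleR_add_left)
  moreover have "orth_proj V = (\<lambda>y. \<Sum>b\<in>B. (b \<bullet> y) *\<^sub>R b)" using op by (rule ext)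
  ultimately have "linear (orth_proj V)" by simp
  then have "proj_mat V *v y = (\<Sum>b\<in>B. (b \<bullet> y) *\<^sub>R b)" for y
    unfolding proj_mat_def using op by (simp add: matrix_works)
  with that[OF fB] B V(2) op show thesis by metis
qed

context
  fixes V :: "(real^'d) set" and k :: nat
  assumes V: "V \<in> grassmannian k"
begin

lemma proj_mat_eq_orth_proj: "proj_mat V *v y = orth_proj V y"
  using proj_mat_orthonormal_basis[OF V] by (metis (no_types))

lemma proj_mat_selfadjoint: "(proj_mat V *v y) \<bullet> z = y \<bullet> (proj_mat V *v z)"
proof -
  obtain B where "\<forall>y. proj_mat V *v y = (\<Sum>b\<in>B. (b \<bullet> y) *\<^sub>R b)"
    using proj_mat_orthonormal_basis[OF V] by blast
  then show ?thesis by (simp add: inner_sum_left inner_sum_right inner_commute mult.commute)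
qed

lemma proj_mat_in: "proj_mat V *v y \<in> V"
proof -
  have sub: "subspace V" using V by (simp add: grassmannian_def)
  obtain B where B: "finite B" "card B = k" "B \<subseteq> V" "\<forall>b\<in>B. norm b = 1"
    "pairwise orthogonal B" "\<forall>y. proj_mat V *v y = (\<Sum>b\<in>B. (b \<bullet> y) *\<^sub>R b)"
    "\<forall>y. orth_proj V y = (\<Sum>b\<in>B. (b \<bullet> y) *\<^sub>R b)"
    by (rule proj_mat_orthonormal_basis[OF V])
  show ?thesis
    using B(3) by (simp only: B(6)[rule_format], intro subspace_sum[OF sub] subspace_scale[OF sub]) auto
qed

lemma proj_mat_fixes: "v \<in> V \<Longrightarrow> proj_mat V *v v = v"
  using V unfolding proj_mat_eq_orth_proj grassmannian_def
  by (intro orth_proj_eqI) (auto simp: orthogonal_def)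

lemma proj_mat_idem: "proj_mat V *v (proj_mat V *v y) = proj_mat V *v y"
  using proj_mat_in by (rule proj_mat_fixes)

lemma norm_proj_mat_square: "(norm (proj_mat V *v y))\<^sup>2 = y \<bullet> (proj_mat V *v y)"
  by (simp add: power2_norm_eq_inner proj_mat_selfadjoint proj_mat_idem)

text \<open>This is the trace of the projector, evaluated as the sum of the squared lengths of an
  orthonormal basis of V.\<close>

lemma sum_norm_proj_mat_axis: "(\<Sum>i\<in>UNIV. (norm (proj_mat V *v axis i 1))\<^sup>2) = real k"
proof -
  obtain B where B: "finite B" "card B = k" "\<forall>b\<in>B. norm b = 1"
    "\<forall>y. proj_mat V *v y = (\<Sum>b\<in>B. (b \<bullet> y) *\<^sub>R b)"
    using proj_mat_orthonormal_basis[OF V] by blast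
  have "(\<Sum>i\<in>UNIV. (norm (proj_mat V *v axis i 1))\<^sup>2) = (\<Sum>i\<in>UNIV. \<Sum>b\<in>B. b $ i * b $ i)"
    unfolding norm_proj_mat_square
    unfolding B(4)[rule_format]
    by (simp add: inner_sum_right inner_axis inner_axis')
  also have "\<dots> = (\<Sum>b\<in>B. b \<bullet> b)"
    by (subst sum.swap) (simp add: inner_vec_def)
  also have "\<dots> = real k" using B by (simp add: norm_eq_1)
  finally show ?thesis .
qed

lemma norm_proj_mat_add_axis:
  "(norm (proj_mat V *v (y + s *\<^sub>R axis i 1)))\<^sup>2 =
   (norm (proj_mat V *v y))\<^sup>2 + 2 * s * (proj_mat V *v y) $ i + s\<^sup>2 * (norm (proj_mat V *v axis i 1))\<^sup>2"
proof -
  have "(proj_mat V *v y) $ i = (proj_mat V *v y) \<bullet> (proj_mat V *v axis i 1)"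
    by (simp add: proj_mat_selfadjoint[of "proj_mat V *v y", symmetric] proj_mat_idem inner_axis)
  then show ?thesis
    unfolding power2_norm_eq_inner matrix_vector_right_distrib matrix_vector_mult_scaleR
    by (simp add: inner_add_left inner_add_right inner_commute power2_eq_square algebra_simps)
qed

end

text \<open>First and second derivatives along a coordinate line, on which the squared norm of a
  projection is a quadratic polynomial q.\<close>

lemma power_quadratic_derivs:
  fixes a b c :: real
  defines "q \<equiv> \<lambda>s. a + 2 * s * b + s\<^sup>2 * c"
  shows "((\<lambda>s. q s ^ Suc m) has_real_derivative (real (Suc m) * q s ^ m * (2 * b + 2 * s * c))) (at s)"
    and "((\<lambda>s. real (Suc m) * q s ^ m * (2 * b + 2 * s * c)) has_real_derivative
          (2 * real (Suc m) * (c * a ^ m + 2 * real m * b\<^sup>2 * a ^ (m - 1)))) (at 0)"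
  unfolding q_def
  by (rule derivative_eq_intros refl | simp add: power2_eq_square algebra_simps)+

text \<open>Compares the Laplacians of both sides of the frame identity, one coordinate at a time.\<close>

lemma tight_frame_lower_degree:
  fixes V :: "nat \<Rightarrow> (real^'d) set"
  assumes V: "\<And>j. j \<in> J \<Longrightarrow> V j \<in> grassmannian k"
    and fr: "\<And>y. (\<Sum>j\<in>J. \<omega> j * norm (proj_mat (V j) *v y) ^ (2 * Suc m)) = A * norm y ^ (2 * Suc m)"
  shows "(2 * real m + real k) * (\<Sum>j\<in>J. \<omega> j * norm (proj_mat (V j) *v y) ^ (2 * m)) =
         A * (2 * real m + real CARD('d)) * norm y ^ (2 * m)"
proof -
  define a where "a j = (norm (proj_mat (V j) *v y))\<^sup>2" for j
  define b where "b j i = (proj_mat (V j) *v y) $ i" for j i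
  define c where "c j i = (norm (proj_mat (V j) *v axis i 1))\<^sup>2" for j i
  define y2 where "y2 = (norm y)\<^sup>2"
  \<comment> \<open>Both sides of the frame identity are differentiated twice along the i-th axis at
    y. On the right the identity matrix takes the place of the projector, hence the coefficient 1
    for \<open>c j i\<close>. The common factor \<open>2 * Suc m\<close> is cancelled.\<close>
  have step: "(\<Sum>j\<in>J. \<omega> j * (c j i * a j ^ m + 2 * real m * (b j i)\<^sup>2 * a j ^ (m - 1)))
      = A * (1 * y2 ^ m + 2 * real m * (y $ i)\<^sup>2 * y2 ^ (m - 1))" (is "?L = ?R") for i
  proof -
    define f where "f s = (\<Sum>j\<in>J. \<omega> j * (a j + 2 * s * b j i + s\<^sup>2 * c j i) ^ Suc m)
        - A * (y2 + 2 * s * (y $ i) + s\<^sup>2 * 1) ^ Suc m" for s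
    define f' where "f' s = (\<Sum>j\<in>J. \<omega> j * (real (Suc m) * (a j + 2 * s * b j i + s\<^sup>2 * c j i) ^ m * (2 * b j i + 2 * s * c j i)))
        - A * (real (Suc m) * (y2 + 2 * s * (y $ i) + s\<^sup>2 * 1) ^ m * (2 * (y $ i) + 2 * s * 1))" for s
    have "f s = 0" for s
    proof -
      have "(norm (y + s *\<^sub>R axis i 1))\<^sup>2 = y2 + 2 * s * (y $ i) + s\<^sup>2 * 1"
        unfolding y2_def power2_norm_eq_inner
        by (simp add: inner_add_left inner_add_right inner_axis inner_axis' power2_eq_square algebra_simps)
      then show ?thesis
        using fr[of "y + s *\<^sub>R axis i 1"] norm_proj_mat_add_axis[OF V]
        unfolding f_def a_def b_def c_def power_mult by (simp only: cong: sum.cong)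
    qed
    then have f0: "f = (\<lambda>s. 0)" by auto
    have "(f has_real_derivative f' s) (at s)" for s
      unfolding f_def f'_def
      by (intro DERIV_diff DERIV_sum DERIV_cmult power_quadratic_derivs(1))
    then have "f' s = 0" for s
      unfolding f0 using DERIV_unique DERIV_const by blast
    then have f'0: "f' = (\<lambda>s. 0)" by auto
    have "(f' has_real_derivative
        (\<Sum>j\<in>J. \<omega> j * (2 * real (Suc m) * (c j i * a j ^ m + 2 * real m * (b j i)\<^sup>2 * a j ^ (m - 1))))
        - A * (2 * real (Suc m) * (1 * y2 ^ m + 2 * real m * (y $ i)\<^sup>2 * y2 ^ (m - 1)))) (at 0)"
      unfolding f'_def
      by (intro DERIV_diff DERIV_sum DERIV_cmult power_quadratic_derivs(2))
    then have "(\<Sum>j\<in>J. \<omega> j * (2 * real (Suc m) * (c j i * a j ^ m + 2 * real m * (b j i)\<^sup>2 * a j ^ (m - 1))))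
        - A * (2 * real (Suc m) * (1 * y2 ^ m + 2 * real m * (y $ i)\<^sup>2 * y2 ^ (m - 1))) = 0"
      unfolding f'0 using DERIV_unique DERIV_const by blast
    then have "2 * real (Suc m) * ?L = 2 * real (Suc m) * ?R"
      by (simp add: sum_distrib_left algebra_simps)
    then show ?thesis by simp
  qed
  \<comment> \<open>The exponent \<open>m - 1\<close> truncates at \<open>m = 0\<close>, where the
    factor \<open>real m\<close> makes both sides 0.\<close>
  have sq: "real m * (u * u ^ (m - 1)) = real m * u ^ m" for u :: real
    by (cases m) auto
  have sumb: "(\<Sum>i\<in>UNIV. (b j i)\<^sup>2) = a j" for j
    unfolding a_def b_def power2_norm_eq_inner by (simp add: inner_vec_def power2_eq_square)
  have sumy: "(\<Sum>i\<in>UNIV. (y $ i)\<^sup>2) = y2"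
    unfolding y2_def power2_norm_eq_inner by (simp add: inner_vec_def power2_eq_square)
  \<comment> \<open>Summation over i: the \<open>c j i\<close> add up to the trace k, and the
    \<open>(b j i)\<^sup>2\<close> to \<open>a j\<close>.\<close>
  have "(\<Sum>i\<in>UNIV. \<Sum>j\<in>J. \<omega> j * (c j i * a j ^ m + 2 * real m * (b j i)\<^sup>2 * a j ^ (m - 1)))
      = (\<Sum>j\<in>J. \<omega> j * ((\<Sum>i\<in>UNIV. c j i) * a j ^ m + 2 * real m * ((\<Sum>i\<in>UNIV. (b j i)\<^sup>2) * a j ^ (m - 1))))"
    by (subst sum.swap)
       (simp add: sum_distrib_left sum_distrib_right sum.distrib distrib_left algebra_simps)
  also have "\<dots> = (\<Sum>j\<in>J. \<omega> j * (real k * a j ^ m + 2 * real m * a j ^ m))"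
    using sum_norm_proj_mat_axis[OF V] sq
    by (intro sum.cong refl) (simp add: sumb c_def mult.assoc)
  also have "\<dots> = (2 * real m + real k) * (\<Sum>j\<in>J. \<omega> j * a j ^ m)"
    by (simp add: sum_distrib_left algebra_simps)
  finally have L: "(\<Sum>i\<in>UNIV. \<Sum>j\<in>J. \<omega> j * (c j i * a j ^ m + 2 * real m * (b j i)\<^sup>2 * a j ^ (m - 1)))
      = (2 * real m + real k) * (\<Sum>j\<in>J. \<omega> j * a j ^ m)" .
  have "(\<Sum>i\<in>(UNIV::'d set). A * (1 * y2 ^ m + 2 * real m * (y $ i)\<^sup>2 * y2 ^ (m - 1)))
      = A * (real CARD('d) * y2 ^ m + 2 * (real m * ((\<Sum>i\<in>UNIV. (y $ i)\<^sup>2) * y2 ^ (m - 1))))"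
    by (simp add: sum_distrib_left sum_distrib_right sum.distrib algebra_simps)
  also have "\<dots> = A * (2 * real m + real CARD('d)) * y2 ^ m"
    unfolding sumy sq by (simp add: algebra_simps)
  finally have R: "(\<Sum>i\<in>(UNIV::'d set). A * (1 * y2 ^ m + 2 * real m * (y $ i)\<^sup>2 * y2 ^ (m - 1)))
      = A * (2 * real m + real CARD('d)) * y2 ^ m" .
  from L[unfolded step R] show ?thesis
    by (simp add: power_mult flip: a_def y2_def)
qed

text \<open>Descending from p, the frame is tight for every exponent with some constant. Ascending
  from the total weight 1 at exponent 0, each step multiplies the constant by
  \<open>(k/2 + l) / (d/2 + l)\<close>.\<close>

lemma tight_frame_moments:
  fixes V :: "nat \<Rightarrow> (real^'d) set"
  assumes V: "\<And>j. j \<in> J \<Longrightarrow> V j \<in> grassmannian k" and k: "1 \<le> k" and \<omega>: "(\<Sum>j\<in>J. \<omega> j) = 1"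
    and fr: "\<And>y. (\<Sum>j\<in>J. \<omega> j * norm (proj_mat (V j) *v y) ^ (2 * p)) = A * norm y ^ (2 * p)"
    and l: "l \<le> p"
  shows "(\<Sum>j\<in>J. \<omega> j * norm (proj_mat (V j) *v y) ^ (2 * l)) =
    pochhammer (real k / 2) l / pochhammer (real CARD('d) / 2) l * norm y ^ (2 * l)"
proof -
  have ex: "\<exists>A. \<forall>y. (\<Sum>j\<in>J. \<omega> j * norm (proj_mat (V j) *v y) ^ (2 * l)) = A * norm y ^ (2 * l)"
    if "l \<le> p" for l
    using that
  proof (induction l rule: inc_induct)
    case base
    then show ?case using fr by blast
  next
    case (step l)
    then obtain A where A: "\<And>y. (\<Sum>j\<in>J. \<omega> j * norm (proj_mat (V j) *v y) ^ (2 * Suc l)) = A * norm y ^ (2 * Suc l)"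
      by blast
    have "(\<Sum>j\<in>J. \<omega> j * norm (proj_mat (V j) *v y) ^ (2 * l)) =
        A * (2 * real l + real CARD('d)) / (2 * real l + real k) * norm y ^ (2 * l)" for y
      using tight_frame_lower_degree[OF V A, of y] k by (simp add: field_simps)
    then show ?case by blast
  qed
  show ?thesis
    using l
  proof (induction l arbitrary: y)
    case 0
    then show ?case using \<omega> by simp
  next
    case (Suc l)
    obtain A where A: "\<And>y. (\<Sum>j\<in>J. \<omega> j * norm (proj_mat (V j) *v y) ^ (2 * Suc l)) = A * norm y ^ (2 * Suc l)"
      using ex[OF Suc.prems] by blast
    \<comment> \<open>At a unit vector the identities become equations between the
      constants.\<close>
    define e :: "real^'d" where "e = axis undefined 1"
    have e: "norm e = 1" by (simp add: e_def)
    have e1: "(2 * real l + real k) * (pochhammer (real k / 2) l / pochhammer (real CARD('d) / 2) l)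
        = A * (2 * real l + real CARD('d))"
      using tight_frame_lower_degree[OF V A, of e] Suc.IH[of e] Suc.prems e by simp
    have e2: "0 < pochhammer (real CARD('d) / 2) l"
      by (intro pochhammer_pos) simp
    have e3: "0 < 2 * real l + real CARD('d)" by (simp add: add_nonneg_pos)
    have "A = (2 * real l + real k) * pochhammer (real k / 2) l
        / ((2 * real l + real CARD('d)) * pochhammer (real CARD('d) / 2) l)"
    proof -
      have "A = u * x / (v * z)" if "u * (x / z) = A * v" "0 < z" "0 < v" for u v x z :: real
        using that by (simp add: field_simps)
      then show ?thesis using e1 e2 e3 by blast
    qed
    also have "\<dots> = ((real k / 2 + real l) * pochhammer (real k / 2) l)
        / ((real CARD('d) / 2 + real l) * pochhammer (real CARD('d) / 2) l)"
    proof -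
      have "2 * real l + u = 2 * (u / 2 + real l)" for u by simp
      then show ?thesis by (metis (no_types) mult.assoc mult_divide_mult_cancel_left zero_neq_numeral)
    qed
    also have "\<dots> = pochhammer (real k / 2) (Suc l) / pochhammer (real CARD('d) / 2) (Suc l)"
      by (simp only: pochhammer_rec')
    finally have "A = pochhammer (real k / 2) (Suc l) / pochhammer (real CARD('d) / 2) (Suc l)" .
    then show ?case using A by simp
  qed
qed

section \<open>Invariance under the orthogonal group\<close>

lemma trace_inner_point_proj: "trace_inner (point_proj x) A = x \<bullet> (A *v x)"
  unfolding trace_inner_def trace_def matrix_matrix_mult_def point_proj_def matrix_vector_mult_def inner_vec_def
  by (simp add: sum_distrib_left mult.assoc mult.left_commute) (subst sum.swap, simp add: algebra_simps)

lemma orthogonal_matrix_inner: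
  "orthogonal_matrix (Q::real^'d^'d) \<Longrightarrow> (Q *v x) \<bullet> (Q *v y) = x \<bullet> y"
  using orthogonal_transformation_matrix[of "(*v) Q"] by (simp add: orthogonal_transformation_def)

lemma proj_mat_image:
  fixes Q :: "real^'d^'d"
  assumes Q: "orthogonal_matrix Q" and V: "V \<in> grassmannian k"
  shows "(\<lambda>v. Q *v v) ` V \<in> grassmannian k"
    and "proj_mat ((\<lambda>v. Q *v v) ` V) = Q ** proj_mat V ** transpose Q"
proof -
  have inv: "Q ** transpose Q = mat 1" "transpose Q ** Q = mat 1"
    using Q by (auto simp: orthogonal_matrix_def)
  have sub: "subspace V" using V by (simp add: grassmannian_def)
  have "inj ((*v) Q)"
    by (metis (no_types) injI inv(2) matrix_vector_mul_assoc matrix_vector_mul_lid)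
  then show W: "(\<lambda>v. Q *v v) ` V \<in> grassmannian k"
    using V by (auto simp: grassmannian_def dim_image_eq linear_subspace_image inj_on_subset
        intro: dim_image_eq)
  show "proj_mat ((\<lambda>v. Q *v v) ` V) = Q ** proj_mat V ** transpose Q"
  proof (rule matrix_eq[THEN iffD2], rule allI)
    fix y
    have "orth_proj ((\<lambda>v. Q *v v) ` V) y = Q *v (proj_mat V *v (transpose Q *v y))"
    proof (rule orth_proj_eqI)
      show "subspace ((\<lambda>v. Q *v v) ` V)" using W by (simp add: grassmannian_def)
      show "Q *v (proj_mat V *v (transpose Q *v y)) \<in> (\<lambda>v. Q *v v) ` V"
        using proj_mat_in[OF V] by blast
      fix v assume "v \<in> (\<lambda>v. Q *v v) ` V"
      then obtain z where z: "z \<in> V" "v = Q *v z" by blast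
      let ?t = "transpose Q *v y"
      have y: "y = Q *v ?t" by (simp only: matrix_vector_mul_assoc inv matrix_vector_mul_lid)
      have "(y - Q *v (proj_mat V *v ?t)) \<bullet> v = ?t \<bullet> z - (proj_mat V *v ?t) \<bullet> z"
        unfolding z(2) inner_diff_left
        by (subst y) (simp only: orthogonal_matrix_inner[OF Q])
      also have "\<dots> = 0" using proj_mat_selfadjoint[OF V] proj_mat_fixes[OF V z(1)] by simp
      finally show "orthogonal (y - Q *v (proj_mat V *v ?t)) v" by (simp add: orthogonal_def)
    qed
    then show "proj_mat ((\<lambda>v. Q *v v) ` V) *v y = Q ** proj_mat V ** transpose Q *v y"
      by (simp only: proj_mat_eq_orth_proj[OF W] matrix_vector_mul_assoc matrix_mul_assoc)
  qed
qed

text \<open>For W in the Grassmann space this is the product of the squared norms of the projections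
  of x and y to W.\<close>

definition proj_product :: "real^'d \<Rightarrow> real^'d \<Rightarrow> (real^'d) set \<Rightarrow> real" where
  "proj_product x y W = (x \<bullet> (proj_mat W *v x)) * (y \<bullet> (proj_mat W *v y))"

lemma proj_product_cubature4:
  assumes "norm x = 1" "norm y = 1"
  shows "proj_product x y \<in> cubature4_functions"
  unfolding cubature4_functions_def
  using assms
  by (intro CollectI exI[of _ 1] exI[of _ "\<lambda>_. 1"] exI[of _ "\<lambda>_. x"] exI[of _ "\<lambda>_. y"])
     (simp add: proj_product_def[abs_def] trace_inner_point_proj)

lemma proj_product_image:
  assumes "orthogonal_matrix Q" "V \<in> grassmannian k"
  shows "proj_product (Q *v x) (Q *v y) ((\<lambda>v. Q *v v) ` V) = proj_product x y V"
proof -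
  have "Q ** proj_mat V ** transpose Q *v (Q *v x) = Q *v (proj_mat V *v x)" for x
  proof -
    have "Q ** proj_mat V ** transpose Q *v (Q *v x) = Q ** proj_mat V ** (transpose Q ** Q) *v x"
      by (simp only: matrix_vector_mul_assoc matrix_mul_assoc)
    also have "transpose Q ** Q = mat 1" using assms(1) by (simp add: orthogonal_matrix_def)
    finally show ?thesis by (simp add: matrix_vector_mul_assoc)
  qed
  then show ?thesis
    by (simp add: proj_product_def proj_mat_image[OF assms] orthogonal_matrix_inner[OF assms(1)])
qed

lemma continuous_on_matrix_mult [continuous_intros]:
  fixes f :: "'a::topological_space \<Rightarrow> real^'n^'m" and g :: "'a \<Rightarrow> real^'k^'n"
  assumes "continuous_on S f" "continuous_on S g"
  shows "continuous_on S (\<lambda>x. f x ** g x)"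
  unfolding matrix_matrix_mult_def
  by (intro continuous_on_vec_lambda continuous_on_sum continuous_on_mult continuous_on_component assms)

lemma continuous_on_transpose [continuous_intros]:
  fixes f :: "'a::topological_space \<Rightarrow> real^'n^'m"
  assumes "continuous_on S f"
  shows "continuous_on S (\<lambda>x. transpose (f x))"
  unfolding transpose_def
  by (intro continuous_on_vec_lambda continuous_on_component assms)

text \<open>Applying Q to both vectors has the same effect as moving the subspace by the transpose
  of Q, which left invariance of the Haar measure absorbs.\<close>

lemma haar_integral_proj_product:
  fixes \<mu> :: "(real^'d^'d) measure"
  assumes haar: "haar_probability \<mu>" and k: "k \<le> CARD('d)" and Q: "orthogonal_matrix Q"
  shows "(LINT W|grassmann_measure \<mu> k. proj_product (Q *v x) (Q *v y) W) =
         (LINT W|grassmann_measure \<mu> k. proj_product x y W)"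
proof -
  define V0 :: "(real^'d) set" where "V0 = (SOME V. V \<in> grassmannian k)"
  \<comment> \<open>The base point in \<open>grassmann_measure\<close> is picked by choice, so a
    subspace of dimension k has to exist.\<close>
  have "\<exists>V::(real^'d) set. V \<in> grassmannian k"
    using choose_subspace_of_subspace[of k "UNIV :: (real^'d) set"] k
    by (auto simp: grassmannian_def)
  then have V0: "V0 \<in> grassmannian k" unfolding V0_def by (rule someI_ex)
  define N where "N = vimage_algebra (grassmannian k) (proj_mat :: (real^'d) set \<Rightarrow> _) borel"
  define g where "g R = (\<lambda>v. R *v v) ` V0" for R :: "real^'d^'d"
  have space: "space \<mu> = orthogonal_group" and sets: "sets \<mu> = sets (restrict_space borel orthogonal_group)"
    and inv: "\<And>Q. Q \<in> orthogonal_group \<Longrightarrow> distr \<mu> \<mu> (\<lambda>R. Q ** R) = \<mu>"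
    using haar unfolding haar_probability_def by auto
  have Qt: "transpose Q \<in> orthogonal_group" "transpose Q ** Q = mat 1"
    using Q by (auto simp: orthogonal_group_def orthogonal_matrix_transpose orthogonal_matrix_def)
  have borel_meas: "f \<in> measurable \<mu> borel" if "continuous_on UNIV f" for f :: "real^'d^'d \<Rightarrow> 'e::topological_space"
    unfolding measurable_cong_sets[OF sets refl]
    using that by (intro measurable_restrict_space1 borel_measurable_continuous_onI)
  have g_in: "g R \<in> grassmannian k" "proj_mat (g R) = R ** proj_mat V0 ** transpose R"
    if "R \<in> space \<mu>" for R
    using proj_mat_image[OF _ V0, of R] that by (auto simp: space orthogonal_group_def g_def)
  have gm: "g \<in> measurable \<mu> N"
    unfolding N_def
  proof (rule measurable_vimage_algebra2)
    show "g \<in> space \<mu> \<rightarrow> grassmannian k" using g_in by blast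
    have "(\<lambda>R. R ** proj_mat V0 ** transpose R) \<in> borel_measurable \<mu>"
      by (intro borel_meas continuous_intros)
    then show "(\<lambda>R. proj_mat (g R)) \<in> borel_measurable \<mu>"
      using g_in(2) by (simp cong: measurable_cong)
  qed
  have pm: "proj_product x y \<in> borel_measurable N" for x y :: "real^'d"
  proof -
    have "proj_mat \<in> borel_measurable N"
      unfolding N_def by (rule measurable_vimage_algebra1) simp
    moreover have "(\<lambda>A::real^'d^'d. (x \<bullet> (A *v x)) * (y \<bullet> (A *v y))) \<in> borel_measurable borel"
      unfolding matrix_vector_mult_def
      by (intro borel_measurable_continuous_onI continuous_intros continuous_on_vec_lambda continuous_on_component)
    ultimately show ?thesis
      unfolding proj_product_def[abs_def] by (rule measurable_compose)
  qed
  have eq: "(LINT W|grassmann_measure \<mu> k. f W) = (LINT R|\<mu>. f (g R))"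
    if "f \<in> borel_measurable N" for f :: "(real^'d) set \<Rightarrow> real"
  proof -
    have "grassmann_measure \<mu> k = distr \<mu> N g"
      unfolding grassmann_measure_def N_def V0_def g_def[abs_def] ..
    then show ?thesis using integral_distr[OF gm that] by simp
  qed
  have tm: "(\<lambda>R. transpose Q ** R) \<in> measurable \<mu> \<mu>"
    unfolding measurable_cong_sets[OF refl sets]
  proof (rule measurable_restrict_space2)
    show "(\<lambda>R. transpose Q ** R) \<in> space \<mu> \<rightarrow> orthogonal_group"
      using Qt(1) by (auto simp: space orthogonal_group_def orthogonal_matrix_mul)
  qed (intro borel_meas continuous_intros)
  have "(LINT R|\<mu>. proj_product (Q *v x) (Q *v y) (g R)) = (LINT R|\<mu>. proj_product x y (g (transpose Q ** R)))"
  proof (rule Bochner_Integration.integral_cong[OF refl])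
    fix R assume R: "R \<in> space \<mu>"
    have "g (transpose Q ** R) = (\<lambda>v. transpose Q *v v) ` g R"
      unfolding g_def by (simp only: image_image matrix_vector_mul_assoc)
    moreover have "orthogonal_matrix (transpose Q)" using Qt(1) by (simp add: orthogonal_group_def)
    from proj_product_image[OF this g_in(1)[OF R], of "Q *v x" "Q *v y"]
    have "proj_product x y ((\<lambda>v. transpose Q *v v) ` g R) = proj_product (Q *v x) (Q *v y) (g R)"
      by (simp add: matrix_vector_mul_assoc Qt(2))
    ultimately show "proj_product (Q *v x) (Q *v y) (g R) = proj_product x y (g (transpose Q ** R))"
      by simp
  qed
  also have "\<dots> = (LINT R|distr \<mu> \<mu> (\<lambda>R. transpose Q ** R). proj_product x y (g R))"
    using tm measurable_compose[OF gm pm] by (intro integral_distr[symmetric])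
  also have "\<dots> = (LINT R|\<mu>. proj_product x y (g R))"
    by (simp add: inv[OF Qt(1)])
  finally show ?thesis by (simp add: eq[OF pm])
qed

text \<open>The reflection in the hyperplane orthogonal to \<open>a - b\<close>; for
  \<open>a = b\<close> the formula gives the identity.\<close>

lemma reflection_swapping:
  fixes a b :: "real^'d"
  assumes "norm a = norm b"
  obtains Q where "orthogonal_matrix Q" "Q *v a = b" "\<And>x. x \<bullet> (a - b) = 0 \<Longrightarrow> Q *v x = x"
proof -
  define v where "v = a - b"
  define f where "f y = y - (2 * (v \<bullet> y) / (v \<bullet> v)) *\<^sub>R v" for y
  have lin: "linear f"
    unfolding f_def
    by (rule linearI) (simp_all add: inner_add_right algebra_simps add_divide_distrib)
  have "norm (f y) = norm y" for y
  proof -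
    have "f y \<bullet> f y = y \<bullet> y"
      unfolding f_def by (simp add: inner_diff_left inner_diff_right inner_commute field_simps)
    then show ?thesis by (simp add: norm_eq)
  qed
  then have "orthogonal_transformation f" using lin by (simp add: orthogonal_transformation)
  then have Q: "orthogonal_matrix (matrix f)" by (simp add: orthogonal_transformation_matrix)
  have app: "matrix f *v y = f y" for y using lin by (simp add: matrix_works)
  have "f a = b"
  proof (cases "v = 0")
    case False
    have "a \<bullet> a = b \<bullet> b" using assms by (simp add: norm_eq)
    then have "2 * (v \<bullet> a) = v \<bullet> v"
      unfolding v_def by (simp add: inner_diff_left inner_diff_right inner_commute)
    then show ?thesis using False unfolding f_def by (simp add: v_def)
  qed (simp add: f_def v_def)
  moreover have "f x = x" if "x \<bullet> (a - b) = 0" for x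
    using that unfolding f_def v_def by (simp add: inner_commute)
  ultimately show thesis using that[OF Q] app by simp
qed

section \<open>The reconstruction formula\<close>

text \<open>On unit vectors q depends only on the inner product with x. Splitting y into its
  component along x and a vector orthogonal to x, this invariance removes the mixed term.\<close>

lemma reflection_invariant_quadratic_form:
  fixes M :: "real^'d^'d" and x :: "real^'d"
  defines "q \<equiv> \<lambda>y. y \<bullet> (M *v y)"
  assumes x: "norm x = 1"
    and inv: "\<And>y y'. norm y = 1 \<Longrightarrow> norm y' = 1 \<Longrightarrow> x \<bullet> y = x \<bullet> y' \<Longrightarrow> q y = q y'"
  shows "\<exists>w. \<forall>y. q y = (q x - w) * (x \<bullet> y)\<^sup>2 + w * (norm y)\<^sup>2"
proof -
  have sc: "q (c *\<^sub>R y) = c\<^sup>2 * q y" for c y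
    unfolding q_def by (simp add: matrix_vector_mult_scaleR power2_eq_square)
  have par: "q (a + b) + q (a - b) = 2 * q a + 2 * q b" for a b
    unfolding q_def
    by (simp add: matrix_vector_right_distrib matrix_vector_mult_diff_distrib inner_add_left
        inner_add_right inner_diff_left inner_diff_right)
  \<comment> \<open>The common value of q on the unit vectors orthogonal to x; if there are none,
    any w serves.\<close>
  obtain w where w: "\<And>z. norm z = 1 \<Longrightarrow> x \<bullet> z = 0 \<Longrightarrow> q z = w"
  proof (cases "\<exists>z. norm z = 1 \<and> x \<bullet> z = 0")
    case True
    then obtain z0 where z0: "norm z0 = 1" "x \<bullet> z0 = 0" by blast
    show thesis
    proof (rule that)
      fix z assume z: "norm z = 1" "x \<bullet> z = 0"
      show "q z = q z0" by (rule inv[OF z(1) z0(1)]) (simp only: z(2) z0(2))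
    qed
  qed (use that in blast)
  have perp: "q b = w * (norm b)\<^sup>2" if "x \<bullet> b = 0" for b
  proof (cases "b = 0")
    case True
    then show ?thesis by (simp add: q_def)
  next
    case False
    let ?z = "(1 / norm b) *\<^sub>R b"
    have "q ?z = w" using False that by (intro w) simp_all
    moreover have "b = norm b *\<^sub>R ?z" using False by simp
    ultimately show ?thesis by (metis sc mult.commute)
  qed
  have unit: "q y = (q x - w) * (x \<bullet> y)\<^sup>2 + w" if y: "norm y = 1" for y
  proof -
    define a where "a = (x \<bullet> y) *\<^sub>R x"
    define b where "b = y - a"
    have xx: "x \<bullet> x = 1" and yy: "y \<bullet> y = 1" using x y by (simp_all add: norm_eq_1)
    have xb: "x \<bullet> b = 0" by (simp add: b_def a_def inner_diff_right xx)
    have ab: "a \<bullet> b = 0" by (simp add: a_def xb)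
    have aa: "a \<bullet> a = (x \<bullet> y)\<^sup>2" by (simp add: a_def xx power2_eq_square)
    have yab: "y = a + b" by (simp add: b_def)
    have "a \<bullet> a + b \<bullet> b = 1"
      using yy unfolding yab by (simp add: inner_add_left inner_add_right ab inner_commute[of b a])
    then have bb: "b \<bullet> b = 1 - (x \<bullet> y)\<^sup>2" using aa by simp
    \<comment> \<open>The mirror image \<open>a - b\<close> of y has the same inner product with x,
      so q agrees at both, and the parallelogram law yields \<open>q a + q b\<close>.\<close>
    have "norm (a - b) = 1"
      using aa bb by (simp add: norm_eq_1 inner_diff_left inner_diff_right ab inner_commute[of b a])
    moreover have "x \<bullet> y = x \<bullet> (a - b)" by (simp add: yab inner_add_right inner_diff_right xb)
    ultimately have "q (a + b) = q (a - b)" using inv[OF y] yab by simp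
    then have "q y = q a + q b" using par[of a b] yab by simp
    also have "q a = (x \<bullet> y)\<^sup>2 * q x" by (simp add: a_def sc)
    also have "q b = w * (1 - (x \<bullet> y)\<^sup>2)" using perp[OF xb] bb by (simp add: power2_norm_eq_inner)
    finally show ?thesis by (simp add: algebra_simps)
  qed
  have "q y = (q x - w) * (x \<bullet> y)\<^sup>2 + w * (norm y)\<^sup>2" for y
  proof (cases "y = 0")
    case True
    then show ?thesis by (simp add: q_def)
  next
    case False
    let ?u = "(1 / norm y) *\<^sub>R y"
    have y: "y = norm y *\<^sub>R ?u" using False by simp
    have "q y = (norm y)\<^sup>2 * q ?u" by (metis y sc)
    also have "q ?u = (q x - w) * (x \<bullet> ?u)\<^sup>2 + w" using False by (intro unit) simp
    also have "(norm y)\<^sup>2 * \<dots> = (q x - w) * (x \<bullet> y)\<^sup>2 + w * (norm y)\<^sup>2"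
      using False by (simp add: power_divide field_simps)
    finally show ?thesis .
  qed
  then show ?thesis by blast
qed

text \<open>Polarization: for a self-adjoint matrix the quadratic form determines the bilinear
  form.\<close>

lemma symmetric_matrix_eqI:
  fixes M N :: "real^'d^'d"
  assumes "\<And>y z. (M *v y) \<bullet> z = y \<bullet> (M *v z)" "\<And>y z. (N *v y) \<bullet> z = y \<bullet> (N *v z)"
    and "\<And>y. y \<bullet> (M *v y) = y \<bullet> (N *v y)"
  shows "M = N"
proof -
  have "y \<bullet> (M *v z) = y \<bullet> (N *v z)" for y z
  proof -
    have pol: "(y + z) \<bullet> (K *v (y + z)) = y \<bullet> (K *v y) + z \<bullet> (K *v z) + 2 * (y \<bullet> (K *v z))"
      if "\<And>y z. (K *v y) \<bullet> z = y \<bullet> (K *v z)" for K :: "real^'d^'d"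
      using that[of y z] by (simp add: matrix_vector_right_distrib inner_add_left inner_add_right inner_commute)
    show ?thesis using pol[OF assms(1)] pol[OF assms(2)] assms(3) by simp
  qed
  then have "M *v z = N *v z" for z using vector_eq_rdot[of "M *v z" "N *v z"] by (simp add: inner_commute)
  then show ?thesis by (simp add: matrix_eq)
qed

lemma point_proj_apply: "point_proj x *v y = (x \<bullet> y) *\<^sub>R x"
  by (simp add: point_proj_def matrix_vector_mult_def inner_vec_def vec_eq_iff sum_distrib_left
      sum_distrib_right mult.assoc mult.commute mult.left_commute)

lemma
  fixes x :: "real^'d"
  assumes x: "norm x = 1"
  shows range_point_proj: "range (\<lambda>v. point_proj x *v v) = span {x}"
    and rank_point_proj: "rank (point_proj x) = 1"
    and point_proj_idem: "point_proj x ** point_proj x = point_proj x"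
proof -
  have xx: "x \<bullet> x = 1" and x0: "x \<noteq> 0" using x by (auto simp: norm_eq_1)
  show r: "range (\<lambda>v. point_proj x *v v) = span {x}"
  proof (intro equalityI subsetI)
    fix v assume "v \<in> span {x}"
    then obtain c where "v = c *\<^sub>R x" by (auto simp: span_singleton)
    then have "v = point_proj x *v (c *\<^sub>R x)" by (simp add: point_proj_apply xx)
    then show "v \<in> range (\<lambda>v. point_proj x *v v)" by blast
  qed (auto simp: point_proj_apply span_singleton)
  show "rank (point_proj x) = 1" using x0 by (simp add: rank_dim_range r)
  show "point_proj x ** point_proj x = point_proj x"
    by (simp add: matrix_eq point_proj_apply xx flip: matrix_vector_mul_assoc)
qed

lemma unit_span_singleton_eq:
  fixes x \<xi> :: "real^'d"
  assumes "norm x = 1" "norm \<xi> = 1" "span {x} = span {\<xi>}"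
  shows "x = \<xi> \<or> x = - \<xi>"
proof -
  have "x \<in> span {\<xi>}" using assms(3) span_base[of x "{x}"] by simp
  then obtain c where c: "x = c *\<^sub>R \<xi>" by (auto simp: span_singleton)
  then have "\<bar>c\<bar> = 1" using assms by simp
  then show ?thesis using c by (cases "c \<ge> 0") auto
qed

text \<open>The sum in the reconstruction formula when every value is the true squared norm of the
  projection of x.\<close>

definition weighted_proj_sum ::
    "nat \<Rightarrow> (nat \<Rightarrow> (real^'d) set) \<Rightarrow> (nat \<Rightarrow> real) \<Rightarrow> real^'d \<Rightarrow> real^'d^'d" where
  "weighted_proj_sum n V \<omega> x =
     (\<Sum>j=1..n. (\<omega> j * (norm (proj_mat (V j) *v x))\<^sup>2) *\<^sub>R proj_mat (V j))"

lemma matrix_vector_mult_sum: "(\<Sum>j\<in>J. M j) *v y = (\<Sum>j\<in>J. M j *v y)"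
  for M :: "'j \<Rightarrow> real^'n^'m"
  by (induction J rule: infinite_finite_induct) (auto simp: matrix_vector_mult_add_rdistrib)

lemma weighted_proj_sum_apply:
  "weighted_proj_sum n V \<omega> x *v y =
   (\<Sum>j=1..n. (\<omega> j * (norm (proj_mat (V j) *v x))\<^sup>2) *\<^sub>R (proj_mat (V j) *v y))"
  unfolding weighted_proj_sum_def by (simp add: matrix_vector_mult_sum scaleR_matrix_vector_assoc)

context
  fixes \<mu> :: "(real^'d^'d) measure" and V :: "nat \<Rightarrow> (real^'d) set" and \<omega> :: "nat \<Rightarrow> real"
    and k n :: nat
  assumes haar: "haar_probability \<mu>" and k: "1 \<le> k" "k < CARD('d)"
    and V: "\<forall>j\<in>{1..n}. V j \<in> grassmannian k"
    and cub: "cubature_strength4 (grassmann_measure \<mu> k) n V \<omega>"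
begin

lemma weighted_proj_sum_quadratic_form:
  "y \<bullet> (weighted_proj_sum n V \<omega> x *v y) = (\<Sum>j=1..n. \<omega> j * proj_product x y (V j))"
  unfolding weighted_proj_sum_apply inner_sum_right proj_product_def
proof (intro sum.cong refl)
  fix j assume "j \<in> {1..n}"
  then have "V j \<in> grassmannian k" using V by blast
  then show "y \<bullet> ((\<omega> j * (norm (proj_mat (V j) *v x))\<^sup>2) *\<^sub>R (proj_mat (V j) *v y))
      = \<omega> j * ((x \<bullet> (proj_mat (V j) *v x)) * (y \<bullet> (proj_mat (V j) *v y)))"
    by (simp add: norm_proj_mat_square)
qed

text \<open>The cubature identity replaces the finite sum by the integral, which is invariant under
  the orthogonal group.\<close>

lemma weighted_proj_sum_invariant:
  assumes Q: "orthogonal_matrix Q" and "norm x = 1" "norm y = 1"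
  shows "(Q *v y) \<bullet> (weighted_proj_sum n V \<omega> (Q *v x) *v (Q *v y)) =
    y \<bullet> (weighted_proj_sum n V \<omega> x *v y)"
proof -
  have unit: "norm (Q *v x) = 1" "norm (Q *v y) = 1"
    using assms orthogonal_matrix_inner[OF Q] by (simp_all add: norm_eq_1)
  have "(LINT W|grassmann_measure \<mu> k. f W) = (\<Sum>j=1..n. \<omega> j * f (V j))"
    if "f \<in> cubature4_functions" for f
    using cub that unfolding cubature_strength4_def by blast
  then show ?thesis
    unfolding weighted_proj_sum_quadratic_form
    using haar_integral_proj_product[OF haar _ Q, of k x y] k(2)
      proj_product_cubature4[OF unit] proj_product_cubature4[OF assms(2,3)] by simp
qed

text \<open>Invariance under the orthogonal maps fixing x leaves a form with two unknowns U and w.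
  The fourth moment determines U, and the trace then determines w; \<open>coeff_a1\<close> and
  \<open>coeff_a2\<close> are chosen to turn the form into the square of the inner product with
  x.\<close>

lemma weighted_proj_sum_eq:
  assumes x: "norm x = 1"
  shows "coeff_a1 k CARD('d) *\<^sub>R weighted_proj_sum n V \<omega> x - coeff_a2 k CARD('d) *\<^sub>R mat 1 = point_proj x"
proof -
  let ?M = "weighted_proj_sum n V \<omega>" and ?d = "real CARD('d)"
  have V': "V j \<in> grassmannian k" if "j \<in> {1..n}" for j using V that by blast
  have \<omega>: "(\<Sum>j=1..n. \<omega> j) = 1" using cub by (simp add: cubature_strength4_def)
  define U where "U = x \<bullet> (?M x *v x)"
  have "y \<bullet> (?M x *v y) = y' \<bullet> (?M x *v y')"
    if y: "norm y = 1" "norm y' = 1" "x \<bullet> y = x \<bullet> y'" for y y'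
  proof -
    \<comment> \<open>As \<open>y - y'\<close> is orthogonal to x, the reflection exchanging y and
      y' fixes x.\<close>
    obtain Q where Q: "orthogonal_matrix Q" "Q *v y = y'" "\<And>x. x \<bullet> (y - y') = 0 \<Longrightarrow> Q *v x = x"
      using reflection_swapping[of y y'] y by metis
    have "Q *v x = x" using y by (intro Q(3)) (simp add: inner_diff_right)
    then show ?thesis using weighted_proj_sum_invariant[OF Q(1) x y(1)] Q(2) by simp
  qed
  from reflection_invariant_quadratic_form[OF x this]
  obtain w where w: "\<And>y. y \<bullet> (?M x *v y) = (U - w) * (x \<bullet> y)\<^sup>2 + w * (norm y)\<^sup>2"
    unfolding U_def by blast
  \<comment> \<open>Tightness for exponent 2 comes from the cubature, since reflections move x to
    any other unit vector.\<close>
  have fr2: "(\<Sum>j=1..n. \<omega> j * norm (proj_mat (V j) *v y) ^ (2 * 2)) = U * norm y ^ (2 * 2)" for y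
  proof (cases "y = 0")
    case False
    let ?u = "(1 / norm y) *\<^sub>R y"
    have u: "norm ?u = 1" using False by simp
    obtain Q where Q: "orthogonal_matrix Q" "Q *v x = ?u"
      using reflection_swapping[of x ?u] x u by metis
    have "U = ?u \<bullet> (?M ?u *v ?u)"
      using weighted_proj_sum_invariant[OF Q(1) x x] Q(2) by (simp add: U_def)
    also have "\<dots> = (\<Sum>j=1..n. \<omega> j * norm (proj_mat (V j) *v ?u) ^ 4)"
      unfolding weighted_proj_sum_apply inner_sum_right
    proof (intro sum.cong refl)
      fix j assume j: "j \<in> {1..n}"
      show "?u \<bullet> ((\<omega> j * (norm (proj_mat (V j) *v ?u))\<^sup>2) *\<^sub>R (proj_mat (V j) *v ?u))
          = \<omega> j * norm (proj_mat (V j) *v ?u) ^ 4"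
        unfolding inner_scaleR_right norm_proj_mat_square[OF V'[OF j], symmetric]
        by (simp flip: power_add)
    qed
    also have "\<dots> = (\<Sum>j=1..n. \<omega> j * norm (proj_mat (V j) *v y) ^ 4) / norm y ^ 4"
      by (simp add: matrix_vector_mult_scaleR power_divide sum_divide_distrib)
    finally show ?thesis using False by (simp add: field_simps)
  qed simp
  have A2: "U = real k * (real k + 2) / (?d * (?d + 2))"
  proof -
    have "U = pochhammer (real k / 2) 2 / pochhammer (?d / 2) 2"
      using tight_frame_moments[OF V' k(1) \<omega> fr2 order_refl, of x] fr2[of x] x by simp
    also have "\<dots> = (real k / 2 * (real k / 2 + 1)) / (?d / 2 * (?d / 2 + 1))"
      by (simp add: numeral_2_eq_2 pochhammer_Suc)
    also have "\<dots> = real k * (real k + 2) / (?d * (?d + 2))"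
    proof -
      have h: "a / 2 * (a / 2 + 1) = a * (a + 2) / 4" for a :: real by (simp add: field_simps)
      show ?thesis unfolding h by simp
    qed
    finally show ?thesis .
  qed
  have A1: "(\<Sum>j=1..n. \<omega> j * (norm (proj_mat (V j) *v x))\<^sup>2) = real k / ?d"
    using tight_frame_moments[OF V' k(1) \<omega> fr2, of 1 x] x by simp
  \<comment> \<open>The trace of the matrix, computed from the traces k of the projectors, is
    compared with the trace of the normal form.\<close>
  have "(\<Sum>i\<in>UNIV. axis i 1 \<bullet> (?M x *v axis i 1))
      = (\<Sum>j=1..n. \<omega> j * (norm (proj_mat (V j) *v x))\<^sup>2 * (\<Sum>i\<in>UNIV. (norm (proj_mat (V j) *v axis i 1))\<^sup>2))"
    unfolding weighted_proj_sum_apply inner_sum_right sum_distrib_left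
    by (subst sum.swap) (intro sum.cong refl, simp add: norm_proj_mat_square[OF V'])
  also have "\<dots> = (\<Sum>j=1..n. \<omega> j * (norm (proj_mat (V j) *v x))\<^sup>2 * real k)"
    by (intro sum.cong refl) (simp add: sum_norm_proj_mat_axis[OF V'])
  also have "\<dots> = real k * real k / ?d"
    using A1 by (simp flip: sum_distrib_right)
  finally have "(\<Sum>i\<in>UNIV. (U - w) * (x $ i)\<^sup>2 + w) = real k * real k / ?d"
    by (simp add: w inner_axis)
  moreover have "(\<Sum>i\<in>UNIV. (x $ i)\<^sup>2) = 1"
    using x by (simp add: norm_eq_1 inner_vec_def power2_eq_square)
  ultimately have tr: "(U - w) + ?d * w = real k * real k / ?d"
    by (simp add: sum.distrib flip: sum_distrib_left)
  have d: "?d > 1" "real k < ?d" "real k > 0" using k by simp_all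
  have Wd: "w = (real k * real k / ?d - U) / (?d - 1)"
    using tr d by (simp add: field_simps)
  have W: "w = real k * (?d * real k + real k - 2) / (?d * (?d + 2) * (?d - 1))"
    unfolding Wd A2 using d by (simp add: divide_simps) (simp add: algebra_simps)
  have UW: "U - w = 2 * real k * (?d - real k) / (?d * (?d + 2) * (?d - 1))"
    unfolding W A2 using d by (simp add: divide_simps) (simp add: algebra_simps)
  have c1: "coeff_a1 k CARD('d) * (U - w) = 1"
    unfolding UW coeff_a1_def using d by (simp add: divide_simps)
  have c2: "coeff_a1 k CARD('d) * w = coeff_a2 k CARD('d)"
    unfolding W coeff_a1_def coeff_a2_def using d by (simp add: divide_simps)
  let ?N = "coeff_a1 k CARD('d) *\<^sub>R ?M x - coeff_a2 k CARD('d) *\<^sub>R mat 1"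
  have N: "?N *v y = coeff_a1 k CARD('d) *\<^sub>R (?M x *v y) - coeff_a2 k CARD('d) *\<^sub>R y" for y
    by (simp add: matrix_vector_mult_diff_rdistrib scaleR_matrix_vector_assoc[symmetric])
  note pp = point_proj_apply[of x]
  show ?thesis
  proof (rule symmetric_matrix_eqI)
    have "(?M x *v y) \<bullet> z = y \<bullet> (?M x *v z)" for y z
      unfolding weighted_proj_sum_apply inner_sum_left inner_sum_right
      by (intro sum.cong refl) (simp add: proj_mat_selfadjoint[OF V'])
    then show "(?N *v y) \<bullet> z = y \<bullet> (?N *v z)" for y z
      unfolding N by (simp add: inner_diff_left inner_diff_right)
    show "(point_proj x *v y) \<bullet> z = y \<bullet> (point_proj x *v z)" for y z
      by (simp add: pp inner_commute mult.commute)
    show "y \<bullet> (?N *v y) = y \<bullet> (point_proj x *v y)" for y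
    proof -
      have "y \<bullet> (?N *v y) = (coeff_a1 k CARD('d) * (U - w)) * (x \<bullet> y)\<^sup>2
          + (coeff_a1 k CARD('d) * w - coeff_a2 k CARD('d)) * (norm y)\<^sup>2"
        unfolding N by (simp add: inner_diff_right w power2_norm_eq_inner algebra_simps)
      also have "\<dots> = (x \<bullet> y)\<^sup>2" unfolding c1 c2 by simp
      finally show ?thesis by (simp add: pp inner_commute power2_eq_square)
    qed
  qed
qed

end

section \<open>Correctness of the algorithm: existence of an output, its length, and membership of
  x\<close>

theorem theorem4p3:
  fixes \<mu> :: "(real^'d^'d) measure"
    and V :: "nat \<Rightarrow> (real^'d) set"
    and \<omega> :: "nat \<Rightarrow> real"
    and t :: "nat \<Rightarrow> real"
    and x :: "real^'d"
    and k p n :: nat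
  assumes "haar_probability \<mu>"
    and "1 \<le> k" and "k < CARD('d)"
    and "1 \<le> p" and "p \<le> n"
    and "\<forall>j\<in>{1..n}. V j \<in> grassmannian k"
    and "tight_fusion_frame p n V \<omega>"
    and "cubature_strength4 (grassmann_measure \<mu> k) n V \<omega>"
    and "norm x = 1"
    and "t = (\<lambda>j\<in>{p+1..n}. (norm (proj_mat (V j) *v x))\<^sup>2)"
  shows "(\<exists>L. list_reconstruction k p n V \<omega> t L) \<and>
         (\<forall>L. list_reconstruction k p n V \<omega> t L \<longrightarrow>
            length L \<le> 2 * fact p \<and> set L \<subseteq> sphere 0 1 \<and> x \<in> set L)"
proof -
  let ?Z = "solution_set k CARD('d) p n \<omega> t" and ?R = "recon_matrix k p n V \<omega> t"
  let ?rop = "\<lambda>T. real_rank_one_projection (?R T)"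
  note k = assms(2,3) and x = assms(9) and t = assms(10)
  have V: "V j \<in> grassmannian k" if "j \<in> {1..n}" for j using assms(6) that by blast
  have \<omega>pos: "\<omega> j > 0" if "j \<in> {1..n}" for j using assms(7) that by (simp add: tight_fusion_frame_def)
  have \<omega>1: "(\<Sum>j=1..n. \<omega> j) = 1" using assms(8) by (simp add: cubature_strength4_def)
  have \<omega>pos': "0 < \<omega> i" if "i \<in> {1..p}" for i using \<omega>pos that assms(5) by simp
  note fin = finite_card_weighted_power_sum_fibre[of p \<omega>
      "\<lambda>l. of_real (pochhammer (real k / 2) l / pochhammer (real CARD('d) / 2) l
                 - (\<Sum>j=p+1..n. \<omega> j * t j ^ l))", OF \<omega>pos', folded solution_set_def]
  have finZ: "finite ?Z" and cardZ: "card ?Z \<le> fact p"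
    using fin by blast+
  \<comment> \<open>The true values at the unknown indices. They solve the system because the
    moments of x up to exponent p are known.\<close>
  define T0 where "T0 = (\<lambda>j\<in>{1..p}. complex_of_real ((norm (proj_mat (V j) *v x))\<^sup>2))"
  have T0: "T0 \<in> ?Z"
    unfolding solution_set_def
  proof (intro CollectI conjI ballI)
    show "T0 \<in> {1..p} \<rightarrow>\<^sub>E UNIV" by (simp add: T0_def)
    fix l assume l: "l \<in> {1..p}"
    obtain A where "\<And>y. (\<Sum>j=1..n. \<omega> j * norm (proj_mat (V j) *v y) ^ (2 * p)) = A * norm y ^ (2 * p)"
      using assms(7) unfolding tight_fusion_frame_def by blast
    from tight_frame_moments[OF V k(1) \<omega>1 this, of l x] l x
    have "(\<Sum>j=1..n. \<omega> j * ((norm (proj_mat (V j) *v x))\<^sup>2) ^ l)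
        = pochhammer (real k / 2) l / pochhammer (real CARD('d) / 2) l"
      by (simp add: power_mult)
    moreover have "(\<Sum>j=1..n. \<omega> j * ((norm (proj_mat (V j) *v x))\<^sup>2) ^ l)
        = (\<Sum>j=1..p. \<omega> j * ((norm (proj_mat (V j) *v x))\<^sup>2) ^ l)
          + (\<Sum>j=p+1..n. \<omega> j * ((norm (proj_mat (V j) *v x))\<^sup>2) ^ l)"
      using sum.ub_add_nat[of 1 p _ "n - p"] assms(5) by simp
    moreover have "(\<Sum>j=p+1..n. \<omega> j * ((norm (proj_mat (V j) *v x))\<^sup>2) ^ l) = (\<Sum>j=p+1..n. \<omega> j * t j ^ l)"
      by (intro sum.cong refl) (simp add: t)
    ultimately have "(\<Sum>j=1..p. \<omega> j * ((norm (proj_mat (V j) *v x))\<^sup>2) ^ l)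
        = pochhammer (real k / 2) l / pochhammer (real CARD('d) / 2) l - (\<Sum>j=p+1..n. \<omega> j * t j ^ l)"
      by simp
    then have eq: "complex_of_real (\<Sum>j=1..p. \<omega> j * ((norm (proj_mat (V j) *v x))\<^sup>2) ^ l)
        = complex_of_real (pochhammer (real k / 2) l / pochhammer (real CARD('d) / 2) l - (\<Sum>j=p+1..n. \<omega> j * t j ^ l))"
      by (rule arg_cong)
    have "(\<Sum>j=1..p. of_real (\<omega> j) * T0 j ^ l)
        = complex_of_real (\<Sum>j=1..p. \<omega> j * ((norm (proj_mat (V j) *v x))\<^sup>2) ^ l)"
      unfolding of_real_sum by (intro sum.cong refl) (simp add: T0_def)
    with eq show "(\<Sum>j=1..p. of_real (\<omega> j) * T0 j ^ l)
        = complex_of_real (pochhammer (real k / 2) l / pochhammer (real CARD('d) / 2) l - (\<Sum>j=p+1..n. \<omega> j * t j ^ l))"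
      by (rule trans[rotated])
  qed
  \<comment> \<open>At the true values the complex matrix of the algorithm is the projector onto the
    line of x.\<close>
  have R0: "?R T0 $ a $ b = complex_of_real (point_proj x $ a $ b)" for a b
  proof -
    have "?R T0 $ a $ b = of_real (coeff_a1 k CARD('d)) *
        (\<Sum>j=1..n. complex_of_real (\<omega> j * (norm (proj_mat (V j) *v x))\<^sup>2 * proj_mat (V j) $ a $ b))
        - of_real (coeff_a2 k CARD('d)) * of_real ((mat 1 :: real^'d^'d) $ a $ b)"
    proof -
      have "(if j \<le> p then T0 j else of_real (t j)) = complex_of_real ((norm (proj_mat (V j) *v x))\<^sup>2)"
        if "j \<in> {1..n}" for j
        using that by (simp add: T0_def t)
      then show ?thesis by (simp add: recon_matrix_def mat_def)
    qed
    also have "\<dots> = complex_of_real ((coeff_a1 k CARD('d) *\<^sub>R weighted_proj_sum n V \<omega> x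
        - coeff_a2 k CARD('d) *\<^sub>R mat 1) $ a $ b)"
      by (simp add: weighted_proj_sum_def)
    also have "\<dots> = complex_of_real (point_proj x $ a $ b)"
      by (simp only: weighted_proj_sum_eq[OF assms(1) k assms(6,8) x])
    finally show ?thesis .
  qed
  have Re0: "Re_matrix (?R T0) = point_proj x"
    by (simp add: Re_matrix_def R0 vec_eq_iff)
  have rop0: "?rop T0"
    unfolding real_rank_one_projection_def Re0
    using point_proj_idem[OF x] rank_point_proj[OF x]
    by (auto simp: R0 point_proj_def transpose_def vec_eq_iff mult.commute)
  \<comment> \<open>The image of a rank-one projection has an orthonormal basis with one element, so
    the unit vector required by the algorithm always exists.\<close>
  have ex\<xi>: "\<exists>\<xi>. unit_spans_image \<xi> (?R T)" if "?rop T" for T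
  proof -
    let ?P = "Re_matrix (?R T)"
    have sub: "subspace (range (\<lambda>v. ?P *v v))"
      by (intro linear_subspace_image subspace_UNIV) simp
    moreover have "dim (range (\<lambda>v. ?P *v v)) = 1"
      using that by (simp add: real_rank_one_projection_def rank_dim_range)
    ultimately obtain B where B: "\<And>b. b \<in> B \<Longrightarrow> norm b = 1" "card B = 1" "span B = range (\<lambda>v. ?P *v v)"
      using orthonormal_basis_subspace by metis
    from B(2) obtain \<xi> where "B = {\<xi>}" by (rule card_1_singletonE)
    with B have "unit_spans_image \<xi> (?R T)" by (simp add: unit_spans_image_def)
    then show ?thesis by blast
  qed
  show ?thesis
  proof (intro conjI allI impI)
    obtain Ts where "distinct Ts" "set Ts = ?Z" using finite_distinct_list[OF finZ] by blast
    moreover obtain \<xi> where "\<forall>T. ?rop T \<longrightarrow> unit_spans_image (\<xi> T) (?R T)"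
      using ex\<xi> by metis
    ultimately show "\<exists>L. list_reconstruction k p n V \<omega> t L"
      unfolding list_reconstruction_def by blast
  next
    fix L assume "list_reconstruction k p n V \<omega> t L"
    then obtain Ts \<xi> where Ts: "distinct Ts" "set Ts = ?Z"
      and \<xi>: "\<forall>T\<in>set Ts. ?rop T \<longrightarrow> unit_spans_image (\<xi> T) (?R T)"
      and L: "L = concat (map (\<lambda>T. [\<xi> T, - \<xi> T]) (filter ?rop Ts))"
      unfolding list_reconstruction_def by blast
    have "length L = 2 * length (filter ?rop Ts)"
      unfolding L by (simp add: length_concat o_def sum_list_triv)
    also have "length (filter ?rop Ts) \<le> length Ts" by simp
    also have "length Ts \<le> fact p" using Ts cardZ distinct_card by metis
    finally show "length L \<le> 2 * fact p" by simp
    have setL: "set L = (\<Union>T\<in>{T \<in> ?Z. ?rop T}. {\<xi> T, - \<xi> T})"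
      unfolding L using Ts(2) by auto
    show "set L \<subseteq> sphere 0 1"
      using \<xi> Ts(2) unfolding setL by (auto simp: unit_spans_image_def)
    have u: "unit_spans_image (\<xi> T0) (?R T0)" using \<xi> Ts(2) T0 rop0 by blast
    then have "x = \<xi> T0 \<or> x = - \<xi> T0"
      using range_point_proj[OF x] x by (intro unit_span_singleton_eq) (simp_all add: unit_spans_image_def Re0)
    then show "x \<in> set L" unfolding setL using T0 rop0 by blast
  qed
qed

end
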